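(* Let $R=K[x_1,\ldots,x_d]$ be a polynomial ring over a field $K$ and let $I\subset R$ be an ideal whose symbolic Rees algebra $R_s(I)$ is Noetherian. Then the resurgence $\rho(I)$ and the asymptotic resurgence $\widehat{\rho}(I)$ are rational.
   Context: For an ideal $I$ in a polynomial ring $R$ over a field and $s\ge 1$, the $s$-th symbolic power is $I^{(s)}=\bigcap_{P\in\mathrm{Ass}(I)}(I^sR_P\cap R)$, where $\mathrm{Ass}(I)$ is the set of all associated primes of $I$ (i.e. of $R/I$); $I^{(0)}=R$. The symbolic Rees algebra is $R_s(I)=\bigoplus_{s\ge 0}I^{(s)}t^s\subset R[t]$. The resurgence is $\rho(I)=\sup\{\frac{s}{r} : I^{(s)}\not\subset I^r\}$, and the asymptotic resurgence is $\widehat{\rho}(I)=\sup\{\frac{s}{r} : I^{(st)}\not\subset I^{rt}\text{ for all }t\gg 0\}$. *)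

theory Defs
  imports
    "HOL-Algebra.Algebra"
    "HOL-Algebra.Algebraic_Closure_Type"
    "HOL-Library.Poly_Mapping"
    "HOL-Library.Extended_Nonnegative_Real"
begin

text \<open>
  A polynomial is a finitely supported map from exponent vectors to coefficients; the variables
  are indexed by the finite type \<open>'n\<close>, so that \<open>d = CARD('n)\<close>.
\<close>

type_synonym ('n, 'k) mpolynomial = "('n \<Rightarrow>\<^sub>0 nat) \<Rightarrow>\<^sub>0 'k"

definition mpoly_ring :: "('n::finite, 'k::field) mpolynomial ring"
  where "mpoly_ring = ring_of_type_algebra"


definition ideal_power :: "('a, 'b) ring_scheme \<Rightarrow> 'a set \<Rightarrow> nat \<Rightarrow> 'a set"
  where "ideal_power R I n = I [^]\<^bsub>ideals_set R\<^esub> n"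

text \<open>The associated primes of \<open>I\<close>: the prime ideals that annihilate exactly some element of \<open>R/I\<close>.\<close>

definition associated_primes :: "('a, 'b) ring_scheme \<Rightarrow> 'a set \<Rightarrow> 'a set set"
  where "associated_primes R I =
    {P. primeideal P R \<and>
        (\<exists>x \<in> carrier (R Quot I).
           P = {a \<in> carrier R. (I +>\<^bsub>R\<^esub> a) \<otimes>\<^bsub>R Quot I\<^esub> x = \<zero>\<^bsub>R Quot I\<^esub>})}"


text \<open>The ring of fractions \<open>S\<inverse>R\<close>; the fraction \<open>a/s\<close> is the class of the pair \<open>(a, s)\<close>.\<close>

definition frac_rel :: "('a, 'b) ring_scheme \<Rightarrow> 'a set \<Rightarrow> (('a \<times> 'a) \<times> ('a \<times> 'a)) set"
  where "frac_rel R S =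
    {((a, s), (b, t)). a \<in> carrier R \<and> s \<in> S \<and> b \<in> carrier R \<and> t \<in> S \<and>
       (\<exists>u \<in> S. u \<otimes>\<^bsub>R\<^esub> (a \<otimes>\<^bsub>R\<^esub> t \<ominus>\<^bsub>R\<^esub> b \<otimes>\<^bsub>R\<^esub> s) = \<zero>\<^bsub>R\<^esub>)}"

definition fraction :: "('a, 'b) ring_scheme \<Rightarrow> 'a set \<Rightarrow> 'a \<Rightarrow> 'a \<Rightarrow> ('a \<times> 'a) set"
  where "fraction R S a s = frac_rel R S `` {(a, s)}"

definition fraction_ring :: "('a, 'b) ring_scheme \<Rightarrow> 'a set \<Rightarrow> ('a \<times> 'a) set ring"
  where "fraction_ring R S =
    \<lparr>carrier = (carrier R \<times> S) // frac_rel R S,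
     monoid.mult = (\<lambda>A B. \<Union>(a, s) \<in> A. \<Union>(b, t) \<in> B. fraction R S (a \<otimes>\<^bsub>R\<^esub> b) (s \<otimes>\<^bsub>R\<^esub> t)),
     one = fraction R S \<one>\<^bsub>R\<^esub> \<one>\<^bsub>R\<^esub>,
     ring.zero = fraction R S \<zero>\<^bsub>R\<^esub> \<one>\<^bsub>R\<^esub>,
     add = (\<lambda>A B. \<Union>(a, s) \<in> A. \<Union>(b, t) \<in> B.
              fraction R S (a \<otimes>\<^bsub>R\<^esub> t \<oplus>\<^bsub>R\<^esub> b \<otimes>\<^bsub>R\<^esub> s) (s \<otimes>\<^bsub>R\<^esub> t))\<rparr>"

definition localization :: "('a, 'b) ring_scheme \<Rightarrow> 'a set \<Rightarrow> ('a \<times> 'a) set ring"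
  where "localization R P = fraction_ring R (carrier R - P)"

definition to_localization :: "('a, 'b) ring_scheme \<Rightarrow> 'a set \<Rightarrow> 'a \<Rightarrow> ('a \<times> 'a) set"
  where "to_localization R P a = fraction R (carrier R - P) a \<one>\<^bsub>R\<^esub>"

text \<open>\<open>J R\<^sub>P\<close>, and \<open>J R\<^sub>P \<inter> R\<close> read as the preimage under the canonical map \<open>R \<rightarrow> R\<^sub>P\<close>.\<close>

definition extended_ideal :: "('a, 'b) ring_scheme \<Rightarrow> 'a set \<Rightarrow> 'a set \<Rightarrow> ('a \<times> 'a) set set"
  where "extended_ideal R P J = Idl\<^bsub>localization R P\<^esub> (to_localization R P ` J)"

definition local_contraction :: "('a, 'b) ring_scheme \<Rightarrow> 'a set \<Rightarrow> 'a set \<Rightarrow> 'a set"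
  where "local_contraction R P J = {f \<in> carrier R. to_localization R P f \<in> extended_ideal R P J}"


text \<open>The intersection is taken inside \<open>R\<close>, hence equal to \<open>R\<close> if \<open>I\<close> has no associated primes (\<open>I = R\<close>).\<close>

definition symbolic_power :: "('a, 'b) ring_scheme \<Rightarrow> 'a set \<Rightarrow> nat \<Rightarrow> 'a set"
  where "symbolic_power R I s =
    (if s = 0 then carrier R
     else carrier R \<inter> (\<Inter>P \<in> associated_primes R I. local_contraction R P (ideal_power R I s)))"

definition symbolic_Rees_algebra :: "('a, 'b) ring_scheme \<Rightarrow> 'a set \<Rightarrow> ('a, nat \<Rightarrow> 'a) up_ring"
  where "symbolic_Rees_algebra R I =
    (UP R)\<lparr>carrier := {p \<in> carrier (UP R). \<forall>s. up_ring.coeff (UP R) p s \<in> symbolic_power R I s}\<rparr>"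

text \<open>
  The suprema are taken in \<open>[0, \<infinity>]\<close>, so that the supremum of the empty set (which occurs for
  \<open>I = R\<close>) is \<open>0\<close>. No pair with \<open>r = 0\<close> occurs, since \<open>I\<^sup>0 = R\<close>; pairs with \<open>s = 0\<close> contribute
  only the value \<open>0\<close>.
\<close>

definition resurgence :: "('a, 'b) ring_scheme \<Rightarrow> 'a set \<Rightarrow> ennreal"
  where "resurgence R I =
    Sup {ennreal (real s / real r) | s r. \<not> symbolic_power R I s \<subseteq> ideal_power R I r}"

definition asymptotic_resurgence :: "('a, 'b) ring_scheme \<Rightarrow> 'a set \<Rightarrow> ennreal"
  where "asymptotic_resurgence R I =
    Sup {ennreal (real s / real r) | s r.
           \<forall>\<^sub>F t in sequentially. \<not> symbolic_power R I (s * t) \<subseteq> ideal_power R I (r * t)}"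

end

theory Submission
  imports Defs "HOL-Library.Set_Algebras" "HOL-Library.Product_Plus"
begin

text \<open>
  Write \<open>K s\<close> for the \<open>s\<close>-th symbolic power of \<open>I\<close>. The Noetherian symbolic
  Rees algebra is generated in degrees at most some \<open>D\<close>
  (\<open>symbolic_powers_generated_in_bounded_degree\<close>). With \<open>N = D!\<close> and \<open>J = K N\<close>
  this gives \<open>K s \<subseteq> J ^ j\<close> whenever \<open>s \<ge> N * (j + D)\<close>, while \<open>J ^ j
  \<subseteq> K (N * j)\<close>. Up to a bounded shift, symbolic powers are therefore ordinary powers of the ideal
  \<open>J \<subseteq> I\<close>. Let \<open>l\<close> be the supremum of the slopes \<open>p / q\<close> with
  \<open>J ^ q \<subseteq> I ^ p\<close>. Then the asymptotic resurgence is \<open>N / l\<close>, or \<open>0\<close>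
  if the slopes are unbounded. For every \<open>\<beta>\<close> above this value there are only finitely many pairs
  \<open>(s, r)\<close> with \<open>s / r \<ge> \<beta>\<close> and \<open>\<not> K s \<subseteq> I ^ r\<close>; hence
  the resurgence either equals the asymptotic resurgence or is a maximum of finitely many fractions
  (\<open>rational_suprema_from_threshold\<close>).

  It remains to see that a finite \<open>l\<close> is rational (\<open>containment_slope_rational\<close>). The
  classical reason is that \<open>l\<close> is a minimum of quotients of integers \<open>v(J) / v(I)\<close> over the
  Rees valuations of \<open>I\<close>. The proof below uses only Hilbert's basis theorem, in the form of initial
  ideals with respect to a varying weight. Give the ideal \<open>I ^ b * J ^ c\<close> the weight \<open>b + l *
  c\<close> and suppose that \<open>l\<close> is irrational, so that all these weights are different. The elements of
  \<open>I ^ b * J ^ c\<close> that can be rewritten as sums of terms of greater weight form a homogeneous ideal of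
  the bigraded Rees algebra of \<open>I\<close> and \<open>J\<close>. It is finitely generated, and so the rewriting
  is also increasing for the weight \<open>b + l' * c\<close> if \<open>l' < l\<close> is close to \<open>l\<close>
  (\<open>higher_stable\<close>). Choose such an \<open>l'\<close> and a containment \<open>J ^ q \<subseteq> I ^
  p\<close> with \<open>p / q > l'\<close>. It writes \<open>J ^ q\<close> in terms of \<open>l'\<close>-weight
  greater than \<open>l' * q\<close>, and rewriting the term of least \<open>l\<close>-weight over and over leads to
  terms of \<open>l\<close>-weight greater than \<open>l * q\<close> (\<open>push_to_higher_weight\<close>). This is
  an equation of integral dependence, and it yields containments of a slope greater than \<open>l\<close>
  (\<open>power_in_higher_weights_imp_containment\<close>), a contradiction.
\<close>

(* Exponents are pairs that are added as a whole; splitting them would hide the sums k + m from the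
   simplifier. *)
declare split_paired_All [simp del]

section \<open>Ideals, submodules and subrings as sets\<close>

text \<open>
  All rings below are types of class \<open>comm_ring_1\<close>; a sum or product of sets is elementwise, so that
  \<open>ideal_gen (I ^ n)\<close> is the \<open>n\<close>-th power of an ideal \<open>I\<close>. Submodules over a
  subring \<open>A\<close> of the type are the one notion from which ideals (\<open>A = UNIV\<close>) and ideals of
  \<open>A\<close> (submodules inside \<open>A\<close>) arise.
\<close>

definition is_submodule :: "'a::comm_ring_1 set \<Rightarrow> 'a set \<Rightarrow> bool"
  where "is_submodule A S \<longleftrightarrow>
    0 \<in> S \<and> (\<forall>x\<in>S. \<forall>y\<in>S. x + y \<in> S) \<and> (\<forall>a\<in>A. \<forall>x\<in>S. a * x \<in> S)"

abbreviation is_ideal :: "'a::comm_ring_1 set \<Rightarrow> bool"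
  where "is_ideal \<equiv> is_submodule UNIV"

abbreviation ideal_gen :: "'a::comm_ring_1 set \<Rightarrow> 'a set"
  where "ideal_gen G \<equiv> is_ideal hull G"

definition is_subring :: "'a::comm_ring_1 set \<Rightarrow> bool"
  where "is_subring A \<longleftrightarrow>
    1 \<in> A \<and> (\<forall>x\<in>A. \<forall>y\<in>A. x + y \<in> A) \<and> (\<forall>x\<in>A. \<forall>y\<in>A. x * y \<in> A) \<and> (\<forall>x\<in>A. - x \<in> A)"

text \<open>
  Finite generation is phrased by a universal property: \<open>S\<close> lies in every submodule that contains the
  generators. A proof that elements of \<open>S\<close> have some property then never needs to write them as linear
  combinations of the generators.
\<close>

definition is_noetherian :: "'a::comm_ring_1 set \<Rightarrow> bool"
  where "is_noetherian A \<longleftrightarrow>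
    (\<forall>S. S \<subseteq> A \<longrightarrow> is_submodule A S \<longrightarrow>
      (\<exists>G. finite G \<and> G \<subseteq> S \<and> (\<forall>T. is_submodule A T \<longrightarrow> G \<subseteq> T \<longrightarrow> S \<subseteq> T)))"

lemma is_submodule_0: "is_submodule A S \<Longrightarrow> 0 \<in> S"
  and is_submodule_add: "is_submodule A S \<Longrightarrow> x \<in> S \<Longrightarrow> y \<in> S \<Longrightarrow> x + y \<in> S"
  and is_submodule_mult: "is_submodule A S \<Longrightarrow> a \<in> A \<Longrightarrow> x \<in> S \<Longrightarrow> a * x \<in> S"
  unfolding is_submodule_def by blast+

lemma is_subringD:
  assumes "is_subring A"
  shows "0 \<in> A" "1 \<in> A" "\<And>x y. x \<in> A \<Longrightarrow> y \<in> A \<Longrightarrow> x + y \<in> A"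
    "\<And>x y. x \<in> A \<Longrightarrow> y \<in> A \<Longrightarrow> x * y \<in> A" "\<And>x. x \<in> A \<Longrightarrow> - x \<in> A"
proof -
  show "0 \<in> A" using assms unfolding is_subring_def by (metis add.right_inverse)
qed (use assms in \<open>auto simp: is_subring_def\<close>)

lemma is_submodule_diff:
  assumes "is_subring A" "is_submodule A S" "x \<in> S" "y \<in> S"
  shows "x - y \<in> S"
proof -
  have "- 1 * y \<in> S"
    using is_submodule_mult[OF assms(2)] is_subringD(2,5)[OF assms(1)] assms(4) by blast
  then show ?thesis using is_submodule_add[OF assms(2,3)] by fastforce
qed

lemma is_subring_UNIV [simp]: "is_subring UNIV" by (simp add: is_subring_def)

lemma is_submodule_Int: "is_submodule A S \<Longrightarrow> is_submodule A T \<Longrightarrow> is_submodule A (S \<inter> T)"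
  unfolding is_submodule_def by blast

lemma is_submodule_Inter: "Ball \<S> (is_submodule A) \<Longrightarrow> is_submodule A (\<Inter>\<S>)"
  unfolding is_submodule_def by blast

lemma is_submodule_mono: "is_submodule B S \<Longrightarrow> A \<subseteq> B \<Longrightarrow> is_submodule A S"
  unfolding is_submodule_def by blast

lemma is_submodule_chain_Union:
  fixes L :: "nat \<Rightarrow> 'a::comm_ring_1 set"
  assumes "\<And>n. is_submodule A (L n)" "mono L"
  shows "is_submodule A (\<Union>n. L n)"
  unfolding is_submodule_def
proof safe
  show "0 \<in> (\<Union>n. L n)" using assms(1) is_submodule_0 by blast
next
  fix x y m n assume "x \<in> L m" "y \<in> L n"
  then have "x \<in> L (max m n)" "y \<in> L (max m n)"
    using monoD[OF assms(2)] by (meson max.cobounded1 max.cobounded2 subsetD)+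
  then show "x + y \<in> (\<Union>n. L n)" using is_submodule_add[OF assms(1)] by blast
next
  fix a x n assume "a \<in> A" "x \<in> L n"
  then show "a * x \<in> (\<Union>n. L n)" using is_submodule_mult[OF assms(1)] by blast
qed

section \<open>Hilbert's basis theorem for subrings\<close>

text \<open>
  Values at \<open>x\<close> of polynomials of degree less than \<open>n\<close> with coefficients in
  \<open>A\<close>. Adjoining elements of an ambient ring in place of an indeterminate allows any finite number of
  them without a change of type.
\<close>

fun poly_values :: "'a::comm_ring_1 set \<Rightarrow> 'a \<Rightarrow> nat \<Rightarrow> 'a set"
  where "poly_values A x 0 = {0}"
  | "poly_values A x (Suc n) = {a * x ^ n + r | a r. a \<in> A \<and> r \<in> poly_values A x n}"

lemma poly_values_submodule:
  assumes "is_subring A"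
  shows "is_submodule A (poly_values A x n)"
proof (induction n)
  case 0
  then show ?case by (simp add: is_submodule_def)
next
  case (Suc n)
  note P = Suc
  show ?case unfolding is_submodule_def
  proof safe
    show "0 \<in> poly_values A x (Suc n)"
      using is_subringD(1)[OF assms] is_submodule_0[OF P] by force
  next
    fix p q assume "p \<in> poly_values A x (Suc n)" "q \<in> poly_values A x (Suc n)"
    then obtain a r b s where *: "p = a * x ^ n + r" "q = b * x ^ n + s"
      "a \<in> A" "b \<in> A" "r \<in> poly_values A x n" "s \<in> poly_values A x n" by auto
    then have "p + q = (a + b) * x ^ n + (r + s)" by (simp add: algebra_simps)
    then show "p + q \<in> poly_values A x (Suc n)"
      using * is_subringD(3)[OF assms] is_submodule_add[OF P] by (simp only: poly_values.simps) blast
  next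
    fix c p assume "c \<in> A" "p \<in> poly_values A x (Suc n)"
    then obtain a r where *: "p = a * x ^ n + r" "a \<in> A" "r \<in> poly_values A x n" by auto
    then have "c * p = (c * a) * x ^ n + c * r" by (simp add: algebra_simps)
    then show "c * p \<in> poly_values A x (Suc n)"
      using * is_subringD(4)[OF assms] is_submodule_mult[OF P] \<open>c \<in> A\<close>
      by (simp only: poly_values.simps) blast
  qed
qed

lemma poly_values_mono:
  assumes "is_subring A"
  shows "mono (poly_values A x)"
proof -
  have "poly_values A x n \<subseteq> poly_values A x (Suc n)" for n
    using is_subringD(1)[OF assms] by force
  then show ?thesis by (simp add: mono_iff_le_Suc)
qed

lemma poly_values_shift:
  assumes "is_subring A" "p \<in> poly_values A x n"
  shows "x ^ k * p \<in> poly_values A x (n + k)"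
proof -
  have step: "x * p \<in> poly_values A x (Suc n)" if "p \<in> poly_values A x n" for p n
    using that
  proof (induction n arbitrary: p)
    case 0
    then show ?case using is_submodule_0[OF poly_values_submodule[OF assms(1)], of x 1] by simp
  next
    case (Suc n)
    then obtain a r where *: "p = a * x ^ n + r" "a \<in> A" "r \<in> poly_values A x n" by auto
    have "x * p = a * x ^ Suc n + x * r" using * by (simp add: algebra_simps)
    then show ?case using Suc.IH[OF *(3)] *(2) by auto
  qed
  show ?thesis
    by (induction k) (use assms(2) step in \<open>simp_all add: mult.assoc\<close>)
qed

definition adjoin :: "'a::comm_ring_1 set \<Rightarrow> 'a \<Rightarrow> 'a set"
  where "adjoin A x = (\<Union>n. poly_values A x n)"

lemma adjoin_submodule: "is_subring A \<Longrightarrow> is_submodule A (adjoin A x)"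
  unfolding adjoin_def by (intro is_submodule_chain_Union poly_values_submodule poly_values_mono)

lemma subset_adjoin:
  assumes "is_subring A" shows "A \<subseteq> adjoin A x" "x \<in> adjoin A x"
proof -
  show "A \<subseteq> adjoin A x"
  proof
    fix a assume "a \<in> A"
    then have "a * x ^ 0 + 0 \<in> poly_values A x (Suc 0)" by auto
    then have "a \<in> poly_values A x (Suc 0)" by simp
    then show "a \<in> adjoin A x" unfolding adjoin_def by blast
  qed
  have "1 * x ^ 0 + 0 \<in> poly_values A x (Suc 0)" using is_subringD(2)[OF assms] by auto
  then have "x ^ 1 * (1 * x ^ 0 + 0) \<in> poly_values A x (Suc 0 + 1)"
    using poly_values_shift[OF assms] by blast
  then show "x \<in> adjoin A x" unfolding adjoin_def by (auto simp del: poly_values.simps)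
qed

lemma adjoin_subring:
  assumes "is_subring A"
  shows "is_subring (adjoin A x)"
proof -
  note sub = adjoin_submodule[OF assms]
  have shift: "x ^ k * p \<in> adjoin A x" if "p \<in> adjoin A x" for p k
    using that poly_values_shift[OF assms] unfolding adjoin_def by blast
  have mult: "p * q \<in> adjoin A x" if "p \<in> poly_values A x n" "q \<in> adjoin A x" for p q n
    using that(1)
  proof (induction n arbitrary: p)
    case 0
    then show ?case using is_submodule_0[OF sub] by simp
  next
    case (Suc n)
    then obtain a r where *: "p = a * x ^ n + r" "a \<in> A" "r \<in> poly_values A x n" by auto
    have "p * q = a * (x ^ n * q) + r * q" using * by (simp add: algebra_simps)
    then show ?case
      using is_submodule_add[OF sub is_submodule_mult[OF sub *(2) shift[OF that(2)]] Suc.IH[OF *(3)]]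
      by simp
  qed
  have "- p \<in> adjoin A x" if "p \<in> adjoin A x" for p
    using is_submodule_diff[OF assms sub is_submodule_0[OF sub] that] by simp
  moreover have "p * q \<in> adjoin A x" if "p \<in> adjoin A x" "q \<in> adjoin A x" for p q
    using that(1) mult that(2) unfolding adjoin_def[of A x] by blast
  moreover have "1 \<in> adjoin A x" using subset_adjoin(1)[OF assms] is_subringD(2)[OF assms] by blast
  ultimately show ?thesis
    unfolding is_subring_def using is_submodule_add[OF sub] by blast
qed

lemma adjoin_minimal:
  assumes "is_subring B" "A \<subseteq> B" "x \<in> B"
  shows "adjoin A x \<subseteq> B"
proof -
  have pow: "x ^ n \<in> B" for n
    by (induction n) (use is_subringD[OF assms(1)] assms(3) in auto)
  have "poly_values A x n \<subseteq> B" for n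
  proof (induction n)
    case 0 then show ?case using is_subringD[OF assms(1)] by simp
  next
    case (Suc n)
    have "a * x ^ n + r \<in> B" if "a \<in> A" "r \<in> poly_values A x n" for a r
      using that Suc assms(2) pow is_subringD(3,4)[OF assms(1)] by (meson subsetD)
    then show ?case by auto
  qed
  then show ?thesis unfolding adjoin_def by blast
qed

text \<open>
  Hilbert's argument with leading coefficients. Since \<open>x\<close> may be algebraic, an element has no
  well-defined degree or leading coefficient; instead \<open>L T n\<close> collects every coefficient that occurs at
  \<open>x ^ n\<close> in some expression of degree at most \<open>n\<close> for an element of \<open>T\<close>.
\<close>

theorem Hilbert_basis_adjoin:
  assumes A: "is_subring A" and noeth: "is_noetherian A"
  shows "is_noetherian (adjoin A x)"
  unfolding is_noetherian_def
proof (intro allI impI)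
  fix S assume S: "S \<subseteq> adjoin A x" "is_submodule (adjoin A x) S"
  let ?P = "poly_values A x"
  note P = poly_values_submodule[OF A, of x]
  define L where "L T n = {a \<in> A. \<exists>r\<in>?P n. a * x ^ n + r \<in> T}" for T n
  have L_sub: "is_submodule A (L T n)" if "is_submodule (adjoin A x) T" for T n
  proof -
    have T: "is_submodule A T" using is_submodule_mono[OF that subset_adjoin(1)[OF A]] .
    show ?thesis unfolding is_submodule_def
    proof safe
      have "0 * x ^ n + 0 \<in> T" using is_submodule_0[OF T] by simp
      then show "0 \<in> L T n" unfolding L_def using is_submodule_0[OF P] is_subringD(1)[OF A] by blast
    next
      fix a b assume "a \<in> L T n" "b \<in> L T n"
      then obtain r s where *: "a \<in> A" "b \<in> A" "r \<in> ?P n" "s \<in> ?P n"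
        "a * x ^ n + r \<in> T" "b * x ^ n + s \<in> T" unfolding L_def by blast
      have "(a + b) * x ^ n + (r + s) = (a * x ^ n + r) + (b * x ^ n + s)" by (simp add: algebra_simps)
      then have "(a + b) * x ^ n + (r + s) \<in> T" using is_submodule_add[OF T *(5,6)] by (simp only:)
      then show "a + b \<in> L T n"
        unfolding L_def using * is_submodule_add[OF P] is_subringD(3)[OF A] by blast
    next
      fix c a assume c: "c \<in> A" and "a \<in> L T n"
      then obtain r where *: "a \<in> A" "r \<in> ?P n" "a * x ^ n + r \<in> T" unfolding L_def by blast
      have "(c * a) * x ^ n + (c * r) = c * (a * x ^ n + r)" by (simp add: algebra_simps)
      then have "(c * a) * x ^ n + (c * r) \<in> T" using is_submodule_mult[OF T c *(3)] by (simp only:)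
      then show "c * a \<in> L T n"
        unfolding L_def using * c is_submodule_mult[OF P] is_subringD(4)[OF A] by blast
    qed
  qed
  have x_in: "x ^ k \<in> adjoin A x" for k
    by (induction k) (use is_subringD[OF adjoin_subring[OF A]] subset_adjoin[OF A] in auto)
  have L_shift: "L T n \<subseteq> L T (n + k)" if T: "is_submodule (adjoin A x) T" for T n k
  proof
    fix a assume "a \<in> L T n"
    then obtain r where *: "a \<in> A" "r \<in> ?P n" "a * x ^ n + r \<in> T" unfolding L_def by blast
    have "a * x ^ (n + k) + x ^ k * r = x ^ k * (a * x ^ n + r)" by (simp add: algebra_simps power_add)
    then have "a * x ^ (n + k) + x ^ k * r \<in> T" using is_submodule_mult[OF T x_in *(3)] by (simp only:)
    then show "a \<in> L T (n + k)"
      unfolding L_def using * poly_values_shift[OF A] by blast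
  qed
  have "L S i \<subseteq> L S j" if "i \<le> j" for i j
    using L_shift[OF S(2), of i "j - i"] that by simp
  then have "mono (L S)" by (intro monoI)
  then have U: "is_submodule A (\<Union>n. L S n)"
    by (intro is_submodule_chain_Union L_sub S)
  have "(\<Union>n. L S n) \<subseteq> A" unfolding L_def by blast
  then obtain G where G: "finite G" "G \<subseteq> (\<Union>n. L S n)"
      and G_gen: "\<And>T. is_submodule A T \<Longrightarrow> G \<subseteq> T \<Longrightarrow> (\<Union>n. L S n) \<subseteq> T"
    using noeth U unfolding is_noetherian_def by meson
  have "\<exists>m. G \<subseteq> L S m" using G
  proof (induction G rule: finite_induct)
    case (insert g G)
    then obtain m n where "G \<subseteq> L S m" "g \<in> L S n" by blast
    then have "insert g G \<subseteq> L S (max m n)"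
      using monoD[OF \<open>mono (L S)\<close>, of m "max m n"] monoD[OF \<open>mono (L S)\<close>, of n "max m n"] by auto
    then show ?case ..
  qed simp
  then obtain m where "G \<subseteq> L S m" ..
  then have m: "L S n \<subseteq> L S m" for n using G_gen[OF L_sub[OF S(2)]] by blast
  have "\<exists>H. finite H \<and> H \<subseteq> S \<and>
      (\<forall>T. is_submodule (adjoin A x) T \<longrightarrow> H \<subseteq> T \<longrightarrow> L S n \<subseteq> L T n)" for n
  proof -
    have "L S n \<subseteq> A" unfolding L_def by blast
    then obtain G where G: "finite G" "G \<subseteq> L S n"
      and G_gen: "\<And>T. is_submodule A T \<Longrightarrow> G \<subseteq> T \<Longrightarrow> L S n \<subseteq> T"
      using noeth L_sub[OF S(2)] unfolding is_noetherian_def by meson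
    then have "\<forall>a\<in>G. \<exists>r\<in>?P n. a \<in> A \<and> a * x ^ n + r \<in> S" unfolding L_def by blast
    then obtain r where r: "\<forall>a\<in>G. r a \<in> ?P n \<and> a \<in> A \<and> a * x ^ n + r a \<in> S" by metis
    have "L S n \<subseteq> L T n"
      if "is_submodule (adjoin A x) T" "(\<lambda>a. a * x ^ n + r a) ` G \<subseteq> T" for T
      using r that(2) by (intro G_gen L_sub that(1)) (auto simp: L_def)
    then show ?thesis
      using G r by (intro exI[of _ "(\<lambda>a. a * x ^ n + r a) ` G"]) auto
  qed
  then obtain H where H: "\<And>n. finite (H n)" "\<And>n. H n \<subseteq> S"
    "\<And>n T. is_submodule (adjoin A x) T \<Longrightarrow> H n \<subseteq> T \<Longrightarrow> L S n \<subseteq> L T n" by metis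
  have "S \<subseteq> T" if T: "is_submodule (adjoin A x) T" "(\<Union>n\<le>m. H n) \<subseteq> T" for T
  proof -
    (* Intersecting with S keeps the lifted leading terms inside S, so that the remainders of the
       reduction below stay in S. *)
    define T' where "T' = S \<inter> T"
    have T': "is_submodule (adjoin A x) T'" "\<And>n. n \<le> m \<Longrightarrow> H n \<subseteq> T'"
      unfolding T'_def using is_submodule_Int[OF S(2) T(1)] T(2) H(2) by blast+
    have LL: "L S n \<subseteq> L T' n" for n
    proof (cases "n \<le> m")
      case True
      then show ?thesis using H(3) T' by blast
    next
      case False
      then have "L S n \<subseteq> L T' (m + (n - m))"
        using m[of n] H(3)[OF T'(1), of m] T'(2)[of m] L_shift[OF T'(1), of m] by blast
      then show ?thesis using False by simp
    qed
    have "S \<inter> ?P n \<subseteq> T'" for n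
    proof (induction n)
      case 0
      then show ?case using is_submodule_0[OF T'(1)] by auto
    next
      case (Suc n)
      show ?case
      proof
        fix s assume s: "s \<in> S \<inter> ?P (Suc n)"
        then obtain a r where *: "s = a * x ^ n + r" "a \<in> A" "r \<in> ?P n" by auto
        then have "a \<in> L S n" using s unfolding L_def by blast
        then obtain r' where r': "r' \<in> ?P n" "a * x ^ n + r' \<in> T'" using LL unfolding L_def by blast
        have "s - (a * x ^ n + r') \<in> S"
          using is_submodule_diff[OF adjoin_subring[OF A] S(2)] s r' unfolding T'_def by blast
        moreover have "s - (a * x ^ n + r') = r - r'" using * by simp
        moreover have "r - r' \<in> ?P n" using is_submodule_diff[OF A P] * r' by blast
        ultimately have "s - (a * x ^ n + r') \<in> T'" using Suc by (metis IntI subsetD)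
        from is_submodule_add[OF T'(1) this r'(2)] show "s \<in> T'" by simp
      qed
    qed
    then show ?thesis using S(1) unfolding T'_def adjoin_def by blast
  qed
  then show "\<exists>G. finite G \<and> G \<subseteq> S \<and> (\<forall>T. is_submodule (adjoin A x) T \<longrightarrow> G \<subseteq> T \<longrightarrow> S \<subseteq> T)"
    using H(1,2) by (intro exI[of _ "\<Union>n\<le>m. H n"]) blast
qed

lemma noetherian_adjoin_finite:
  assumes "finite E" "is_subring A" "is_noetherian A"
  shows "\<exists>B. is_subring B \<and> is_noetherian B \<and> A \<subseteq> B \<and> E \<subseteq> B \<and>
    (\<forall>C. is_subring C \<longrightarrow> A \<subseteq> C \<longrightarrow> E \<subseteq> C \<longrightarrow> B \<subseteq> C)"
  using assms(1)
proof (induction E rule: finite_induct)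
  case empty
  then show ?case using assms by blast
next
  case (insert x E)
  then obtain B where B: "is_subring B" "is_noetherian B" "A \<subseteq> B" "E \<subseteq> B"
    "\<forall>C. is_subring C \<longrightarrow> A \<subseteq> C \<longrightarrow> E \<subseteq> C \<longrightarrow> B \<subseteq> C" by blast
  have "adjoin B x \<subseteq> C" if "is_subring C" "A \<subseteq> C" "insert x E \<subseteq> C" for C
    using adjoin_minimal[OF that(1), of B x] B(5) that by auto
  moreover have "A \<subseteq> adjoin B x" "insert x E \<subseteq> adjoin B x"
    using subset_adjoin[OF B(1), of x] B(3,4) by auto
  ultimately show ?case
    using adjoin_subring[OF B(1)] Hilbert_basis_adjoin[OF B(1,2)]
    by (intro exI[of _ "adjoin B x"]) simp
qed

section \<open>The bigraded Rees algebra of two ideals\<close>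

lemma ideal_gen_ideal: "is_ideal (ideal_gen G)"
  by (rule hull_in) (rule is_submodule_Inter)

lemma ideal_gen_minimal: "G \<subseteq> T \<Longrightarrow> is_ideal T \<Longrightarrow> ideal_gen G \<subseteq> T"
  by (rule hull_minimal)

lemma is_submodule_sum:
  assumes "is_submodule A S" "\<And>i. i \<in> E \<Longrightarrow> f i \<in> S"
  shows "sum f E \<in> S"
  using assms(2)
  by (induction E rule: infinite_finite_induct)
    (auto intro: is_submodule_0[OF assms(1)] is_submodule_add[OF assms(1)])

text \<open>
  Statements about products with elements of a generated ideal are reduced to the generators by applying
  \<open>hull_minimal\<close> to such a set.
\<close>

lemma is_ideal_mult_preimage:
  assumes "is_ideal T"
  shows "is_ideal {x. x * y \<in> T}"
  unfolding is_submodule_def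
  using is_submodule_0[OF assms] is_submodule_add[OF assms] is_submodule_mult[OF assms]
  by (auto simp: distrib_right mult.assoc)

lemma ideal_gen_mult:
  fixes A B :: "'a::comm_ring_1 set"
  assumes "x \<in> ideal_gen A" "y \<in> ideal_gen B"
  shows "x * y \<in> ideal_gen (A * B)"
proof -
  have "ideal_gen B \<subseteq> {y. y * a \<in> ideal_gen (A * B)}" if "a \<in> A" for a
  proof (rule ideal_gen_minimal[OF _ is_ideal_mult_preimage[OF ideal_gen_ideal]])
    have "b * a \<in> A * B" if "b \<in> B" for b
      using set_times_intro[OF \<open>a \<in> A\<close> that] by (simp add: mult.commute)
    then show "B \<subseteq> {y. y * a \<in> ideal_gen (A * B)}" by (auto intro: hull_inc)
  qed
  then have "ideal_gen A \<subseteq> {x. x * y \<in> ideal_gen (A * B)}"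
    using assms(2)
    by (intro ideal_gen_minimal is_ideal_mult_preimage[OF ideal_gen_ideal])
      (auto simp: mult.commute)
  then show ?thesis using assms(1) by auto
qed

lemma poly_mapping_sum_single: "(\<Sum>k\<in>Poly_Mapping.keys f. Poly_Mapping.single k (Poly_Mapping.lookup f k)) = f"
  by (rule poly_mapping_eqI)
    (auto simp: lookup_sum lookup_single when_def sum.delta' in_keys_iff)

lemma lookup_mult_sum:
  "Poly_Mapping.lookup (f * g) k = (\<Sum>i\<in>Poly_Mapping.keys f. \<Sum>j\<in>Poly_Mapping.keys g. (Poly_Mapping.lookup f i * Poly_Mapping.lookup g j when i + j = k))"
proof -
  have "f * g = (\<Sum>i\<in>Poly_Mapping.keys f. \<Sum>j\<in>Poly_Mapping.keys g. Poly_Mapping.single (i + j) (Poly_Mapping.lookup f i * Poly_Mapping.lookup g j))"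
    by (subst (1) poly_mapping_sum_single[symmetric, of f], subst (1) poly_mapping_sum_single[symmetric, of g])
      (simp add: sum_product mult_single)
  then show ?thesis by (simp add: lookup_sum lookup_single)
qed

text \<open>
  The homogeneous component of degree \<open>k = (b, c)\<close> of the Rees algebra of \<open>I\<close> and
  \<open>J\<close>.
\<close>

definition bipower :: "'a::comm_ring_1 set \<Rightarrow> 'a set \<Rightarrow> nat \<times> nat \<Rightarrow> 'a set"
  where "bipower I J k = ideal_gen (I ^ fst k * J ^ snd k)"

lemma bipower_ideal: "is_ideal (bipower I J k)"
  unfolding bipower_def by (rule ideal_gen_ideal)

lemma bipower_0: "bipower I J 0 = UNIV"
proof -
  have "1 \<in> bipower I J 0" unfolding bipower_def by (auto intro: hull_inc simp: set_times_def)
  then have "a \<in> bipower I J 0" for a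
    using is_submodule_mult[OF bipower_ideal, of a 1 I J 0] by simp
  then show ?thesis by blast
qed

lemma bipower_mult:
  assumes "x \<in> bipower I J k" "y \<in> bipower I J l"
  shows "x * y \<in> bipower I J (k + l)"
proof -
  have "I ^ fst k * J ^ snd k * (I ^ fst l * J ^ snd l) = I ^ fst (k + l) * J ^ snd (k + l)"
    by (simp add: power_add ac_simps)
  then show ?thesis using ideal_gen_mult[of x _ y] assms unfolding bipower_def by metis
qed

lemma bipower_one: "ideal_gen I = bipower I J (1, 0)" "ideal_gen J = bipower I J (0, 1)"
proof -
  have *: "A * {1} = A" "{1} * A = A" for A :: "'a set"
    using mult_1[of A] mult_1_right[of A] by simp_all
  show "ideal_gen I = bipower I J (1, 0)" "ideal_gen J = bipower I J (0, 1)"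
    by (simp_all add: bipower_def *)
qed

lemma noetherian_generators:
  assumes "is_noetherian (UNIV :: 'a::comm_ring_1 set)"
  obtains G where "finite G" "G \<subseteq> ideal_gen I" "ideal_gen G = ideal_gen (I :: 'a set)"
proof -
  obtain G where G: "finite G" "G \<subseteq> ideal_gen I" "\<forall>T. is_ideal T \<longrightarrow> G \<subseteq> T \<longrightarrow> ideal_gen I \<subseteq> T"
    using assms[unfolded is_noetherian_def, rule_format, of "ideal_gen I"] ideal_gen_ideal by blast
  then have "ideal_gen G = ideal_gen I"
    using ideal_gen_ideal hull_subset[of G] ideal_gen_minimal[of G "ideal_gen I"] by blast
  then show ?thesis using that G by blast
qed

lemma constants_noetherian:
  assumes "is_noetherian (UNIV :: 'a::comm_ring_1 set)"
  defines "A \<equiv> range (Poly_Mapping.single (0::nat \<times> nat) :: 'a \<Rightarrow> _)"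
  shows "is_subring A" "is_noetherian A"
proof -
  show "is_subring A"
    unfolding is_subring_def A_def
    by (auto simp: single_one[symmetric] single_add[symmetric] single_uminus[symmetric] mult_single
        simp del: single_one)
  show "is_noetherian A"
    unfolding is_noetherian_def
  proof (intro allI impI)
    fix S assume S: "S \<subseteq> A" "is_submodule A S"
    have pull: "is_ideal {a. Poly_Mapping.single 0 a \<in> T}" if T: "is_submodule A T" for T
      unfolding is_submodule_def
    proof safe
      show "Poly_Mapping.single 0 0 \<in> T" using is_submodule_0[OF T] by simp
    next
      fix x y assume "Poly_Mapping.single 0 x \<in> T" "Poly_Mapping.single 0 y \<in> T"
      then show "Poly_Mapping.single 0 (x + y) \<in> T" using is_submodule_add[OF T] by (simp add: single_add)
    next
      fix a x assume "Poly_Mapping.single 0 x \<in> T"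
      then have "Poly_Mapping.single 0 a * Poly_Mapping.single 0 x \<in> T"
        using is_submodule_mult[OF T] unfolding A_def by blast
      then show "Poly_Mapping.single 0 (a * x) \<in> T" by (simp add: mult_single)
    qed
    obtain G where G: "finite G" "G \<subseteq> {a. Poly_Mapping.single 0 a \<in> S}"
      "\<forall>T. is_ideal T \<longrightarrow> G \<subseteq> T \<longrightarrow> {a. Poly_Mapping.single 0 a \<in> S} \<subseteq> T"
      using assms(1)[unfolded is_noetherian_def, rule_format, OF subset_UNIV pull[OF S(2)]] by blast
    have "S \<subseteq> T" if T: "is_submodule A T" "Poly_Mapping.single 0 ` G \<subseteq> T" for T
    proof -
      have "{a. Poly_Mapping.single 0 a \<in> S} \<subseteq> {a. Poly_Mapping.single 0 a \<in> T}"
        using G(3) pull[OF T(1)] T(2) by blast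
      then show ?thesis using S(1) unfolding A_def by blast
    qed
    then show "\<exists>G. finite G \<and> G \<subseteq> S \<and> (\<forall>T. is_submodule A T \<longrightarrow> G \<subseteq> T \<longrightarrow> S \<subseteq> T)"
      using G(1,2) by (intro exI[of _ "Poly_Mapping.single 0 ` G"]) auto
  qed
qed

text \<open>
  The Rees algebra \<open>R[I u, J v]\<close>, inside the polynomial ring \<open>R[u, v]\<close> represented by
  finitely supported maps on exponent pairs.
\<close>

definition birees :: "'a::comm_ring_1 set \<Rightarrow> 'a set \<Rightarrow> (nat \<times> nat \<Rightarrow>\<^sub>0 'a) set"
  where "birees I J = {f. \<forall>k. Poly_Mapping.lookup f k \<in> bipower I J k}"

lemma birees_subring: "is_subring (birees I J)"
  unfolding is_subring_def
proof (intro conjI ballI)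
  show "1 \<in> birees I J"
    using bipower_0[of I J] is_submodule_0[OF bipower_ideal]
    by (auto simp: birees_def lookup_one when_def)
next
  fix f g assume *: "f \<in> birees I J" "g \<in> birees I J"
  show "f + g \<in> birees I J"
    using * is_submodule_add[OF bipower_ideal, of _ I J] by (simp add: birees_def lookup_add)
  have "(Poly_Mapping.lookup f i * Poly_Mapping.lookup g j when i + j = k) \<in> bipower I J k" for i j k
    using * bipower_mult[of _ I J i _ j] is_submodule_0[OF bipower_ideal, of I J k]
    by (cases "i + j = k") (auto simp: birees_def)
  then have "Poly_Mapping.lookup (f * g) k \<in> bipower I J k" for k
    unfolding lookup_mult_sum by (intro is_submodule_sum[OF bipower_ideal])
  then show "f * g \<in> birees I J" by (simp add: birees_def)
next
  fix f assume *: "f \<in> birees I J"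
  show "- f \<in> birees I J"
    using * is_submodule_diff[OF is_subring_UNIV bipower_ideal is_submodule_0[OF bipower_ideal]]
    by (fastforce simp: birees_def)
qed

text \<open>
  The Rees algebra is obtained from \<open>R\<close> by adjoining \<open>g u\<close> and \<open>h v\<close> for
  finitely many generators \<open>g\<close> of \<open>I\<close> and \<open>h\<close> of \<open>J\<close>, so Hilbert's
  basis theorem applies.
\<close>

lemma birees_noetherian:
  assumes "is_noetherian (UNIV :: 'a::comm_ring_1 set)"
  shows "is_noetherian (birees I (J :: 'a set))"
proof -
  let ?s = "Poly_Mapping.single :: nat \<times> nat \<Rightarrow> 'a \<Rightarrow> _"
  obtain GI GJ where G: "finite GI" "GI \<subseteq> ideal_gen I" "ideal_gen GI = ideal_gen I"
      "finite GJ" "GJ \<subseteq> ideal_gen J" "ideal_gen GJ = ideal_gen J"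
    using noetherian_generators[OF assms] by metis
  obtain B where B: "is_subring B" "is_noetherian B" "range (?s 0) \<subseteq> B"
      "?s (1, 0) ` GI \<union> ?s (0, 1) ` GJ \<subseteq> B"
      and B_min: "\<And>C. is_subring C \<Longrightarrow> range (?s 0) \<subseteq> C \<Longrightarrow> ?s (1, 0) ` GI \<union> ?s (0, 1) ` GJ \<subseteq> C \<Longrightarrow> B \<subseteq> C"
    using noetherian_adjoin_finite[OF _ constants_noetherian[OF assms], of "?s (1, 0) ` GI \<union> ?s (0, 1) ` GJ"]
      G(1,4) by auto
  have single_in: "?s k a \<in> birees I J" if "a \<in> bipower I J k" for k a
    using that is_submodule_0[OF bipower_ideal] by (auto simp: birees_def lookup_single when_def)
  have "B \<subseteq> birees I J"
  proof (rule B_min[OF birees_subring])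
    show "range (?s 0) \<subseteq> birees I J" using single_in bipower_0[of I J] by blast
    show "?s (1, 0) ` GI \<union> ?s (0, 1) ` GJ \<subseteq> birees I J"
      using single_in bipower_one[of I J] bipower_one[of J I] G(2,5) by auto
  qed
  moreover have "birees I J \<subseteq> B"
  proof -
    have ideal_B: "is_ideal {a. ?s k a \<in> B}" for k
      unfolding is_submodule_def
    proof safe
      show "?s k 0 \<in> B" using is_subringD(1)[OF B(1)] by simp
    next
      fix x y assume "?s k x \<in> B" "?s k y \<in> B"
      then show "?s k (x + y) \<in> B" using is_subringD(3)[OF B(1)] by (simp add: single_add)
    next
      fix a x assume "?s k x \<in> B"
      then have "?s 0 a * ?s k x \<in> B" using is_subringD(4)[OF B(1)] B(3) by blast
      then show "?s k (a * x) \<in> B" by (simp add: mult_single)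
    qed
    have I1: "?s (1, 0) a \<in> B" if "a \<in> I" for a
      using ideal_gen_minimal[OF _ ideal_B, of GI "(1, 0)"] B(4) G(3) hull_inc[OF that] by blast
    have J1: "?s (0, 1) a \<in> B" if "a \<in> J" for a
      using ideal_gen_minimal[OF _ ideal_B, of GJ "(0, 1)"] B(4) G(6) hull_inc[OF that] by blast
    have Ib: "?s (b, 0) a \<in> B" if "a \<in> I ^ b" for a b
      using that
    proof (induction b arbitrary: a)
      case 0
      then show ?case using B(3) by (auto simp: zero_prod_def)
    next
      case (Suc b)
      then obtain x y where xy: "a = x * y" "x \<in> I" "y \<in> I ^ b" by (auto simp: set_times_def)
      have "?s (1, 0) x * ?s (b, 0) y \<in> B"
        using is_subringD(4)[OF B(1) I1[OF xy(2)] Suc.IH[OF xy(3)]] .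
      then show ?case using xy(1) by (simp add: mult_single)
    qed
    have Jc: "?s (0, c) a \<in> B" if "a \<in> J ^ c" for a c
      using that
    proof (induction c arbitrary: a)
      case 0
      then show ?case using B(3) by (auto simp: zero_prod_def)
    next
      case (Suc c)
      then obtain x y where xy: "a = x * y" "x \<in> J" "y \<in> J ^ c" by (auto simp: set_times_def)
      have "?s (0, 1) x * ?s (0, c) y \<in> B"
        using is_subringD(4)[OF B(1) J1[OF xy(2)] Suc.IH[OF xy(3)]] .
      then show ?case using xy(1) by (simp add: mult_single)
    qed
    have "?s k a \<in> B" if "a \<in> I ^ fst k * J ^ snd k" for k a
    proof -
      obtain x y where xy: "a = x * y" "x \<in> I ^ fst k" "y \<in> J ^ snd k" using \<open>a \<in> _\<close> by (auto simp: set_times_def)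
      have "?s (fst k, 0) x * ?s (0, snd k) y \<in> B"
        using is_subringD(4)[OF B(1) Ib[OF xy(2)] Jc[OF xy(3)]] .
      then show ?thesis using xy(1) by (simp add: mult_single)
    qed
    then have single_B: "?s k a \<in> B" if "a \<in> bipower I J k" for k a
      using ideal_gen_minimal[OF _ ideal_B, of _ k] that unfolding bipower_def by blast
    have "is_submodule {} B" using is_subringD[OF B(1)] by (simp add: is_submodule_def)
    then have "(\<Sum>k\<in>Poly_Mapping.keys f. ?s k (Poly_Mapping.lookup f k)) \<in> B" if "f \<in> birees I J" for f
      using that single_B by (intro is_submodule_sum) (auto simp: birees_def)
    then show ?thesis unfolding poly_mapping_sum_single by blast
  qed
  ultimately show ?thesis using B(2) by simp
qed

text \<open>
  A family \<open>N\<close> as in the statement is a homogeneous ideal of the Rees algebra; the pairs in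
  \<open>G\<close> are the homogeneous components of a finite set of its generators, with their degrees.
\<close>

lemma bigraded_finitely_generated:
  fixes I J :: "'a::comm_ring_1 set"
  assumes noeth: "is_noetherian (UNIV :: 'a set)"
    and N: "\<And>k. is_ideal (N k)" "\<And>k. N k \<subseteq> bipower I J k"
    and N_mult: "\<And>k l x y. x \<in> bipower I J k \<Longrightarrow> y \<in> N l \<Longrightarrow> x * y \<in> N (k + l)"
  shows "\<exists>G. finite G \<and> (\<forall>(l, a)\<in>G. a \<in> N l) \<and>
    (\<forall>k. N k \<subseteq> ideal_gen {x * a | x l a m. (l, a) \<in> G \<and> m + l = k \<and> x \<in> bipower I J m})"
proof -
  define S where "S = {f. \<forall>k. Poly_Mapping.lookup f k \<in> N k}"
  have S: "S \<subseteq> birees I J" unfolding S_def birees_def using N(2) by blast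
  have "is_submodule (birees I J) S"
    unfolding is_submodule_def
  proof (intro conjI ballI)
    show "0 \<in> S" using is_submodule_0[OF N(1)] by (simp add: S_def)
  next
    fix f g assume "f \<in> S" "g \<in> S"
    then show "f + g \<in> S" using is_submodule_add[OF N(1)] by (simp add: S_def lookup_add)
  next
    fix f g assume "f \<in> birees I J" "g \<in> S"
    then have "Poly_Mapping.lookup (f * g) k \<in> N k" for k
      unfolding lookup_mult_sum
      using N_mult is_submodule_0[OF N(1)]
      by (intro is_submodule_sum[OF N(1)]) (auto simp: birees_def S_def when_def)
    then show "f * g \<in> S" by (simp add: S_def)
  qed
  then obtain H where H: "finite H" "H \<subseteq> S"
    "\<And>T. is_submodule (birees I J) T \<Longrightarrow> H \<subseteq> T \<Longrightarrow> S \<subseteq> T"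
    using birees_noetherian[OF noeth] S unfolding is_noetherian_def by meson
  define G where "G = (\<Union>h\<in>H. (\<lambda>k. (k, Poly_Mapping.lookup h k)) ` Poly_Mapping.keys h)"
  define U where "U k = {x * a | x l a m. (l, a) \<in> G \<and> m + l = k \<and> x \<in> bipower I J m}" for k
  define T where "T = {f. \<forall>k. Poly_Mapping.lookup f k \<in> ideal_gen (U k)}"
  have shift: "x * y \<in> ideal_gen (U (i + j))" if x: "x \<in> bipower I J i" and y: "y \<in> ideal_gen (U j)" for x y i j
  proof -
    have "U j \<subseteq> {y. y * x \<in> ideal_gen (U (i + j))}"
    proof
      fix y assume "y \<in> U j"
      then obtain z l a m where *: "y = z * a" "(l, a) \<in> G" "m + l = j" "z \<in> bipower I J m"
        unfolding U_def by blast
      have "(x * z) * a \<in> U (i + j)"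
        unfolding U_def using *(2,3) bipower_mult[OF x *(4)] add.assoc[of i m l] by blast
      then show "y \<in> {y. y * x \<in> ideal_gen (U (i + j))}"
        using * by (auto intro: hull_inc simp: ac_simps)
    qed
    then have "ideal_gen (U j) \<subseteq> {y. y * x \<in> ideal_gen (U (i + j))}"
      by (intro ideal_gen_minimal is_ideal_mult_preimage ideal_gen_ideal)
    then show ?thesis using y by (auto simp: mult.commute)
  qed
  have T: "is_submodule (birees I J) T"
    unfolding is_submodule_def
  proof (intro conjI ballI)
    show "0 \<in> T"
      using is_submodule_0[OF ideal_gen_ideal] unfolding T_def mem_Collect_eq lookup_zero by blast
  next
    fix f g assume "f \<in> T" "g \<in> T"
    then show "f + g \<in> T"
      unfolding T_def by (auto simp: lookup_add intro: is_submodule_add[OF ideal_gen_ideal])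
  next
    fix f g assume "f \<in> birees I J" "g \<in> T"
    then have "Poly_Mapping.lookup (f * g) k \<in> ideal_gen (U k)" for k
      unfolding lookup_mult_sum
      using shift is_submodule_0[OF ideal_gen_ideal]
      by (intro is_submodule_sum[OF ideal_gen_ideal]) (auto simp: birees_def T_def when_def)
    then show "f * g \<in> T" by (simp add: T_def)
  qed
  have "h \<in> T" if "h \<in> H" for h
  proof -
    have "Poly_Mapping.lookup h k \<in> ideal_gen (U k)" for k
    proof (cases "k \<in> Poly_Mapping.keys h")
      case True
      then have "(k, Poly_Mapping.lookup h k) \<in> G" using that unfolding G_def by blast
      moreover have "0 + k = k" "1 \<in> bipower I J 0" using bipower_0[of I J] by simp_all
      ultimately have "1 * Poly_Mapping.lookup h k \<in> U k" unfolding U_def by blast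
      then show ?thesis by (simp add: hull_inc)
    next
      case False
      then show ?thesis using is_submodule_0[OF ideal_gen_ideal] by (simp add: in_keys_iff)
    qed
    then show ?thesis by (simp add: T_def)
  qed
  then have "S \<subseteq> T" using H(3)[OF T] by blast
  have "N k \<subseteq> ideal_gen (U k)" for k
  proof
    fix a assume "a \<in> N k"
    then have "Poly_Mapping.single k a \<in> S"
      using is_submodule_0[OF N(1)] by (auto simp: S_def lookup_single when_def)
    then have "Poly_Mapping.lookup (Poly_Mapping.single k a) k \<in> ideal_gen (U k)" using \<open>S \<subseteq> T\<close> unfolding T_def by blast
    then show "a \<in> ideal_gen (U k)" by simp
  qed
  moreover have "finite G" using H(1) by (auto simp: G_def)
  moreover have "\<forall>(l, a)\<in>G. a \<in> N l" using H(2) by (auto simp: G_def S_def)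
  ultimately show ?thesis unfolding U_def by blast
qed

section \<open>Weights\<close>

definition bisum :: "'a::comm_ring_1 set \<Rightarrow> 'a set \<Rightarrow> (nat \<times> nat) set \<Rightarrow> 'a set"
  where "bisum I J K = ideal_gen (\<Union>k\<in>K. bipower I J k)"

lemma bisum_ideal: "is_ideal (bisum I J K)"
  unfolding bisum_def by (rule ideal_gen_ideal)

lemma bipower_subset_bisum: "k \<in> K \<Longrightarrow> bipower I J k \<subseteq> bisum I J K"
  unfolding bisum_def by (auto intro!: hull_inc)

lemma bisum_minimal: "(\<And>k. k \<in> K \<Longrightarrow> bipower I J k \<subseteq> T) \<Longrightarrow> is_ideal T \<Longrightarrow> bisum I J K \<subseteq> T"
  unfolding bisum_def by (rule ideal_gen_minimal) auto

lemma bisum_mono: "K \<subseteq> L \<Longrightarrow> bisum I J K \<subseteq> bisum I J L"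
  unfolding bisum_def by (intro hull_mono) auto

lemma bisum_mult:
  assumes "x \<in> bipower I J k" "y \<in> bisum I J K"
  shows "x * y \<in> bisum I J ((+) k ` K)"
proof -
  have "bisum I J K \<subseteq> {y. y * x \<in> bisum I J ((+) k ` K)}"
  proof (rule bisum_minimal[OF _ is_ideal_mult_preimage[OF bisum_ideal]])
    fix l assume l: "l \<in> K"
    show "bipower I J l \<subseteq> {y. y * x \<in> bisum I J ((+) k ` K)}"
    proof
      fix y assume "y \<in> bipower I J l"
      then have "x * y \<in> bipower I J (k + l)" by (rule bipower_mult[OF assms(1)])
      then show "y \<in> {y. y * x \<in> bisum I J ((+) k ` K)}"
        using bipower_subset_bisum[of "k + l" "(+) k ` K" I J] l by (auto simp: mult.commute)
    qed
  qed
  then show ?thesis using assms(2) by (auto simp: mult.commute)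
qed

lemma bisum_insertE:
  assumes "z \<in> bisum I J (insert k K)"
  obtains x y where "x \<in> bipower I J k" "y \<in> bisum I J K" "z = x + y"
proof -
  let ?T = "{x + y | x y. x \<in> bipower I J k \<and> y \<in> bisum I J K}"
  note add = is_submodule_add[OF bipower_ideal] is_submodule_add[OF bisum_ideal]
  note zero = is_submodule_0[OF bipower_ideal] is_submodule_0[OF bisum_ideal]
  have "is_ideal ?T"
    unfolding is_submodule_def
  proof safe
    show "\<exists>x y. 0 = x + y \<and> x \<in> bipower I J k \<and> y \<in> bisum I J K"
      using zero by (metis add.right_neutral)
  next
    fix x y x' y' assume "x \<in> bipower I J k" "x' \<in> bipower I J k" "y \<in> bisum I J K" "y' \<in> bisum I J K"
    then show "\<exists>u v. x + y + (x' + y') = u + v \<and> u \<in> bipower I J k \<and> v \<in> bisum I J K"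
      using add by (metis add.assoc add.left_commute)
  next
    fix a x y assume "x \<in> bipower I J k" "y \<in> bisum I J K"
    then show "\<exists>u v. a * (x + y) = u + v \<and> u \<in> bipower I J k \<and> v \<in> bisum I J K"
      using is_submodule_mult[OF bipower_ideal] is_submodule_mult[OF bisum_ideal]
      by (metis UNIV_I distrib_left)
  qed
  then have "bisum I J (insert k K) \<subseteq> ?T"
  proof (rule bisum_minimal[rotated])
    fix l assume "l \<in> insert k K"
    then consider "l = k" | "l \<in> K" by blast
    then show "bipower I J l \<subseteq> ?T"
    proof cases
      case 1
      have "y \<in> ?T" if "y \<in> bipower I J l" for y
      proof -
        have "y = y + 0" "y \<in> bipower I J k" using that 1 by auto
        then show ?thesis using zero(2) by blast
      qed
      then show ?thesis by blast
    next
      case 2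
      have "y \<in> ?T" if "y \<in> bipower I J l" for y
      proof -
        have "y = 0 + y" "y \<in> bisum I J K" using that bipower_subset_bisum[OF 2, of I J] by auto
        then show ?thesis using zero(1) by blast
      qed
      then show ?thesis by blast
    qed
  qed
  then show ?thesis using assms that by blast
qed

lemma bisum_finite_support:
  assumes "z \<in> bisum I J K"
  obtains L where "finite L" "L \<subseteq> K" "z \<in> bisum I J L"
proof -
  let ?T = "{z. \<exists>L. finite L \<and> L \<subseteq> K \<and> z \<in> bisum I J L}"
  have "is_ideal ?T"
    unfolding is_submodule_def
  proof safe
    show "\<exists>L. finite L \<and> L \<subseteq> K \<and> 0 \<in> bisum I J L"
      using is_submodule_0[OF bisum_ideal] by blast
  next
    fix x y L M assume *: "finite L" "finite M" "L \<subseteq> K" "M \<subseteq> K" "x \<in> bisum I J L" "y \<in> bisum I J M"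
    then have "x + y \<in> bisum I J (L \<union> M)"
      using bisum_mono[of L "L \<union> M" I J] bisum_mono[of M "L \<union> M" I J]
      by (intro is_submodule_add[OF bisum_ideal]) auto
    then show "\<exists>L. finite L \<and> L \<subseteq> K \<and> x + y \<in> bisum I J L"
      using * by (intro exI[of _ "L \<union> M"]) auto
  next
    fix a x L assume "finite L" "L \<subseteq> K" "x \<in> bisum I J L"
    then show "\<exists>L. finite L \<and> L \<subseteq> K \<and> a * x \<in> bisum I J L"
      by (intro exI[of _ L] conjI is_submodule_mult[OF bisum_ideal] UNIV_I)
  qed
  moreover have "bipower I J k \<subseteq> ?T" if "k \<in> K" for k
    using that bipower_subset_bisum[of k "{k}" I J] by (auto intro!: exI[of _ "{k}"])
  ultimately have "bisum I J K \<subseteq> ?T" by (intro bisum_minimal)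
  then show ?thesis using assms that by blast
qed

lemma bisum_finite_support_ideal:
  fixes I J S :: "'a::comm_ring_1 set"
  assumes noeth: "is_noetherian (UNIV :: 'a set)" and "S \<subseteq> bisum I J K"
  obtains L where "finite L" "L \<subseteq> K" "S \<subseteq> bisum I J L"
proof -
  obtain G where G: "finite G" "G \<subseteq> ideal_gen S" "ideal_gen G = ideal_gen S"
    using noetherian_generators[OF noeth] by metis
  have "G \<subseteq> bisum I J K" using G(2) ideal_gen_minimal[OF assms(2) bisum_ideal] by blast
  then have "\<forall>g\<in>G. \<exists>L. finite L \<and> L \<subseteq> K \<and> g \<in> bisum I J L"
    using bisum_finite_support by (metis subsetD)
  then obtain L where L: "\<And>g. g \<in> G \<Longrightarrow> finite (L g) \<and> L g \<subseteq> K \<and> g \<in> bisum I J (L g)" by metis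
  have "G \<subseteq> bisum I J (\<Union>g\<in>G. L g)"
  proof
    fix g assume "g \<in> G"
    then show "g \<in> bisum I J (\<Union>g\<in>G. L g)" using L[of g] bisum_mono[of "L g" "\<Union>g\<in>G. L g" I J] by auto
  qed
  then have "S \<subseteq> bisum I J (\<Union>g\<in>G. L g)"
    using ideal_gen_minimal[OF _ bisum_ideal, of G] G(3) hull_subset[of S is_ideal] by blast
  then show ?thesis using that[of "\<Union>g\<in>G. L g"] L G(1) by blast
qed

text \<open>
  If \<open>l\<close> is the supremum of the slopes \<open>p / q\<close> with \<open>J ^ q \<subseteq> I ^ p\<close>,
  then \<open>J\<close> behaves like a fractional power \<open>I ^ l\<close>, and \<open>weight l (b, c)\<close> is
  the exponent of \<open>I\<close> that measures \<open>I ^ b * J ^ c\<close>.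
\<close>

definition weight :: "real \<Rightarrow> nat \<times> nat \<Rightarrow> real"
  where "weight l k = real (fst k) + l * real (snd k)"

lemma weight_add: "weight l (k + m) = weight l k + weight l m"
  by (simp add: weight_def algebra_simps)

lemma weight_inj:
  assumes "l \<notin> \<rat>" "weight l k = weight l m"
  shows "k = m"
proof (cases "snd k = snd m")
  case True
  then have "fst k = fst m" using assms(2) by (simp add: weight_def)
  then show ?thesis using True by (rule prod_eqI)
next
  case False
  have "l * (real (snd k) - real (snd m)) = real (fst m) - real (fst k)"
    using assms(2) by (simp add: weight_def algebra_simps)
  then have "l = (real (fst m) - real (fst k)) / (real (snd k) - real (snd m))"
    using False by (simp add: eq_divide_eq)
  also have "\<dots> \<in> \<rat>" by simp
  finally show ?thesis using assms(1) by simp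
qed

lemma finite_weight_less:
  assumes "l > 0"
  shows "finite {k. weight l k < t}"
proof -
  have "{k. weight l k < t} \<subseteq> {..nat \<lceil>t\<rceil>} \<times> {..nat \<lceil>t / l\<rceil>}"
  proof
    fix k assume k: "k \<in> {k. weight l k < t}"
    moreover have "0 \<le> l * real (snd k)" using assms by simp
    ultimately have *: "real (fst k) < t" "l * real (snd k) < t"
      unfolding weight_def mem_Collect_eq by linarith+
    have "real (snd k) < t / l" using *(2) assms by (simp add: less_divide_eq mult.commute)
    with *(1) have "real (fst k) < t" "real (snd k) < t / l" .
    then show "k \<in> {..nat \<lceil>t\<rceil>} \<times> {..nat \<lceil>t / l\<rceil>}"
      by (simp add: mem_Times_iff) linarith
  qed
  then show ?thesis by (rule finite_subset) simp
qed

lemma eventually_weight_less: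
  assumes "weight l k < weight l m"
  shows "\<forall>\<^sub>F l' in at l within A. weight l' k < weight l' m"
proof -
  have "((\<lambda>l'. weight l' m - weight l' k) \<longlongrightarrow> weight l m - weight l k) (at l within A)"
    unfolding weight_def by (intro tendsto_intros)
  then have "\<forall>\<^sub>F l' in at l within A. 0 < weight l' m - weight l' k"
    using assms by (intro order_tendstoD) auto
  then show ?thesis by eventually_elim simp
qed

text \<open>
  The elements of \<open>I ^ b * J ^ c\<close> that can be rewritten in terms of greater weight, equivalently the
  leading forms of lowest weight of the relations that hold between elements of the \<open>I ^ b * J ^ c\<close>.
\<close>

definition higher :: "'a::comm_ring_1 set \<Rightarrow> 'a set \<Rightarrow> real \<Rightarrow> nat \<times> nat \<Rightarrow> 'a set"
  where "higher I J l k = bipower I J k \<inter> bisum I J {m. weight l k < weight l m}"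

text \<open>
  The sets \<open>higher I J l k\<close> form a homogeneous ideal of the Rees algebra. For each of its finitely many
  generators a rewriting into terms of greater weight uses finitely many exponents, hence amounts to finitely many
  strict inequalities, which survive a small change of \<open>l\<close>; multiplication shifts both sides of such an
  inequality by the same amount. This is the local constancy of initial ideals under a perturbation of the weight.
\<close>

lemma higher_stable:
  fixes I J :: "'a::comm_ring_1 set"
  assumes noeth: "is_noetherian (UNIV :: 'a set)"
  shows "\<forall>\<^sub>F l' in at l within A. \<forall>k.
    higher I J l k \<subseteq> bisum I J {m. weight l k < weight l m \<and> weight l' k < weight l' m}"
proof -
  have mult: "x * y \<in> higher I J l (k + j)" if "x \<in> bipower I J k" "y \<in> higher I J l j" for x y k j
  proof -
    have "(+) k ` {m. weight l j < weight l m} \<subseteq> {m. weight l (k + j) < weight l m}"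
      by (auto simp: weight_add)
    moreover have "x * y \<in> bisum I J ((+) k ` {m. weight l j < weight l m})"
      using that(2) unfolding higher_def by (intro bisum_mult[OF that(1)]) simp
    moreover have "x * y \<in> bipower I J (k + j)"
      using that(2) unfolding higher_def by (intro bipower_mult[OF that(1)]) simp
    ultimately show ?thesis unfolding higher_def using bisum_mono by blast
  qed
  have "\<exists>G. finite G \<and> (\<forall>(j, a)\<in>G. a \<in> higher I J l j) \<and>
    (\<forall>k. higher I J l k \<subseteq> ideal_gen {x * a | x j a m. (j, a) \<in> G \<and> m + j = k \<and> x \<in> bipower I J m})"
  proof (rule bigraded_finitely_generated[OF noeth])
    show "is_ideal (higher I J l k)" for k
      unfolding higher_def by (intro is_submodule_Int bipower_ideal bisum_ideal)
    show "higher I J l k \<subseteq> bipower I J k" for k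
      unfolding higher_def by blast
  qed (rule mult)
  then obtain G where G: "finite G" "\<And>j a. (j, a) \<in> G \<Longrightarrow> a \<in> higher I J l j"
    "\<And>k. higher I J l k \<subseteq> ideal_gen {x * a | x j a m. (j, a) \<in> G \<and> m + j = k \<and> x \<in> bipower I J m}"
    by blast
  have "\<exists>L. finite L \<and> (\<forall>m\<in>L. weight l (fst g) < weight l m) \<and> snd g \<in> bisum I J L" if "g \<in> G" for g
  proof -
    have "snd g \<in> bisum I J {m. weight l (fst g) < weight l m}"
      using G(2)[of "fst g" "snd g"] that by (simp add: higher_def)
    from bisum_finite_support[OF this] obtain L where
      "finite L" "L \<subseteq> {m. weight l (fst g) < weight l m}" "snd g \<in> bisum I J L" .
    then show ?thesis by (intro exI[of _ L]) auto
  qed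
  then obtain L where L: "\<And>g. g \<in> G \<Longrightarrow> finite (L g)"
    "\<And>g m. g \<in> G \<Longrightarrow> m \<in> L g \<Longrightarrow> weight l (fst g) < weight l m"
    "\<And>g. g \<in> G \<Longrightarrow> snd g \<in> bisum I J (L g)" by metis
  have "\<forall>\<^sub>F l' in at l within A. \<forall>g\<in>G. \<forall>m\<in>L g. weight l' (fst g) < weight l' m"
    by (intro eventually_ball_finite ballI eventually_weight_less G(1) L(1,2))
  then show ?thesis
  proof eventually_elim
    case (elim l')
    show ?case
    proof
      fix k
      let ?K = "{m. weight l k < weight l m \<and> weight l' k < weight l' m}"
      have "x * a \<in> bisum I J ?K" if *: "(j, a) \<in> G" "m + j = k" "x \<in> bipower I J m" for x j a m
      proof -
        have "x * a \<in> bisum I J ((+) m ` L (j, a))"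
          using bisum_mult[OF *(3)] L(3)[OF *(1)] by simp
        moreover have "(+) m ` L (j, a) \<subseteq> ?K"
          using L(2)[OF *(1)] elim *(1,2) by (fastforce simp: weight_add)
        ultimately show ?thesis using bisum_mono by blast
      qed
      then have "ideal_gen {x * a | x j a m. (j, a) \<in> G \<and> m + j = k \<and> x \<in> bipower I J m} \<subseteq> bisum I J ?K"
        by (intro ideal_gen_minimal bisum_ideal) blast
      then show "higher I J l k \<subseteq> bisum I J ?K" using G(3) by blast
    qed
  qed
qed

text \<open>
  A term of least \<open>l\<close>-weight below the weight of \<open>k0\<close> is the difference between an element
  of \<open>S\<close> and terms of greater weight. So it belongs to \<open>higher\<close> and can be replaced by terms
  that are greater for both weights. For an irrational \<open>l\<close> no two exponents have the same weight, so each
  replacement removes a whole weight, and only finitely many weights lie below that of \<open>k0\<close>.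
\<close>

lemma push_to_higher_weight:
  fixes I J :: "'a::comm_ring_1 set"
  assumes l: "l \<notin> \<rat>" "l > 0"
    and stable: "\<And>k. higher I J l k \<subseteq> bisum I J {m. weight l k < weight l m \<and> weight l' k < weight l' m}"
    and S: "S \<subseteq> bipower I J k0" "S \<subseteq> bisum I J {m. weight l' k0 < weight l' m}"
  shows "S \<subseteq> bisum I J {m. weight l k0 < weight l m}"
proof -
  define Z where "Z t = {m. weight l' k0 < weight l' m \<and> t < weight l m}" for t
  have fin: "finite {m \<in> Z t. weight l m < weight l k0}" for t
    using finite_weight_less[OF l(2)] by simp
  have "S \<subseteq> bisum I J {m. weight l k0 < weight l m}" if "S \<subseteq> bisum I J (Z t)" for t
    using that
  proof (induction "card {m \<in> Z t. weight l m < weight l k0}" arbitrary: t rule: less_induct)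
    case less
    show ?case
    proof (cases "{m \<in> Z t. weight l m < weight l k0} = {}")
      case True
      have "Z t \<subseteq> {m. weight l k0 < weight l m}"
      proof
        fix m assume m: "m \<in> Z t"
        then have "m \<noteq> k0" by (auto simp: Z_def)
        then have "weight l m \<noteq> weight l k0" using weight_inj[OF l(1)] by blast
        then show "m \<in> {m. weight l k0 < weight l m}" using True m by force
      qed
      then show ?thesis using less.prems bisum_mono by blast
    next
      case False
      (* m0 is the only exponent of its weight, so a single term of each element has to be replaced. *)
      define m0 where "m0 = arg_min_on (weight l) {m \<in> Z t. weight l m < weight l k0}"
      have m0: "m0 \<in> Z t" "weight l m0 < weight l k0"
        using arg_min_if_finite(1)[OF fin False, of "weight l"] by (simp_all add: m0_def)
      have min: "weight l m0 \<le> weight l m" if "m \<in> Z t" "weight l m < weight l k0" for m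
        using arg_min_least[OF fin False, of m "weight l"] that by (simp add: m0_def)
      let ?t = "weight l m0"
      have Z_t: "Z t \<subseteq> insert m0 (Z ?t)"
      proof
        fix m assume m: "m \<in> Z t"
        have "?t \<le> weight l m" using min[OF m] m0(2) by linarith
        then have "m = m0 \<or> ?t < weight l m" using weight_inj[OF l(1), of m m0] by linarith
        then show "m \<in> insert m0 (Z ?t)" using m unfolding Z_def by blast
      qed
      have "S \<subseteq> bisum I J (Z ?t)"
      proof
        fix g assume g: "g \<in> S"
        then obtain x y where xy: "x \<in> bipower I J m0" "y \<in> bisum I J (Z ?t)" "g = x + y"
          using less.prems bisum_mono[OF Z_t, of I J] by (blast elim: bisum_insertE)
        have "g \<in> bisum I J {m. ?t < weight l m}"
          using g S(1) bipower_subset_bisum[of k0 "{m. ?t < weight l m}" I J] m0(2) by blast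
        moreover have "y \<in> bisum I J {m. ?t < weight l m}"
          using xy(2) bisum_mono[of "Z ?t" "{m. ?t < weight l m}" I J] by (auto simp: Z_def)
        ultimately have "x \<in> bisum I J {m. ?t < weight l m}"
          using is_submodule_diff[OF is_subring_UNIV bisum_ideal] xy(3) by (metis add_diff_cancel_right')
        then have "x \<in> bisum I J {m. ?t < weight l m \<and> weight l' m0 < weight l' m}"
          using stable[of m0] xy(1) by (auto simp: higher_def)
        moreover have "{m. ?t < weight l m \<and> weight l' m0 < weight l' m} \<subseteq> Z ?t"
          using m0(1) by (auto simp: Z_def)
        ultimately have "x \<in> bisum I J (Z ?t)" using bisum_mono by blast
        then show "g \<in> bisum I J (Z ?t)"
          unfolding xy(3) using is_submodule_add[OF bisum_ideal] xy(2) by blast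
      qed
      moreover have "{m \<in> Z ?t. weight l m < weight l k0} \<subset> {m \<in> Z t. weight l m < weight l k0}"
        using m0 by (auto simp: Z_def)
      ultimately show ?thesis using less.hyps psubset_card_mono[OF fin] by blast
    qed
  qed
  (* Weights are nonnegative, so the bound -1 excludes no exponent. *)
  moreover have "Z (-1) = {m. weight l' k0 < weight l' m}"
  proof -
    have "-1 < weight l m" for m using l(2) by (simp add: weight_def add_nonneg_nonneg less_le_trans[of "-1" 0])
    then show ?thesis by (simp add: Z_def)
  qed
  ultimately show ?thesis using S(2) by metis
qed

section \<open>Rationality of the containment slope\<close>

lemma subset_bisumI:
  "k \<in> K \<Longrightarrow> S \<subseteq> bipower I J k \<Longrightarrow> S \<subseteq> bisum I J K"
  by (rule subset_trans[OF _ bipower_subset_bisum])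

lemma subset_bisum_mono:
  "K \<subseteq> L \<Longrightarrow> S \<subseteq> bisum I J K \<Longrightarrow> S \<subseteq> bisum I J L"
  by (rule subset_trans[OF _ bisum_mono])

lemma set_power_mono:
  fixes I J :: "'a::comm_monoid_mult set"
  assumes "J \<subseteq> I" shows "J ^ n \<subseteq> I ^ n"
proof (induction n)
  case (Suc n)
  then show ?case using set_times_mono2[OF assms] by simp
qed simp

lemma bipower_trade:
  assumes "J \<subseteq> I" "i \<le> c"
  shows "bipower I J (b, c) \<subseteq> bipower I J (b + i, c - i)"
proof -
  have "J ^ c = J ^ i * J ^ (c - i)" using assms(2) by (simp add: power_add[symmetric])
  then have "I ^ b * J ^ c = I ^ b * J ^ i * J ^ (c - i)" by (simp add: mult.assoc)
  also have "\<dots> \<subseteq> I ^ b * I ^ i * J ^ (c - i)"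
    by (intro set_times_mono2 set_power_mono assms(1) subset_refl)
  finally show ?thesis unfolding bipower_def by (intro hull_mono) (simp add: power_add)
qed

lemma bipower_subset_power:
  assumes "p \<le> b"
  shows "bipower I J (b, c) \<subseteq> ideal_gen (I ^ p)"
  unfolding bipower_def
proof (intro ideal_gen_minimal ideal_gen_ideal)
  have "I ^ b = I ^ (b - p) * I ^ p" using assms by (simp add: power_add[symmetric])
  then have "I ^ b * J ^ c = I ^ (b - p) * J ^ c * I ^ p" by (simp only: ac_simps)
  moreover have "a * b \<in> ideal_gen (I ^ p)" if "b \<in> I ^ p" for a b
    by (rule is_submodule_mult[OF ideal_gen_ideal UNIV_I hull_inc[OF that]])
  then have "A * I ^ p \<subseteq> ideal_gen (I ^ p)" for A
    by (auto simp: set_times_def)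
  ultimately show "I ^ fst (b, c) * J ^ snd (b, c) \<subseteq> ideal_gen (I ^ p)" by simp
qed

lemma power_snd_subset_bipower: "J ^ q \<subseteq> bipower I J (0, q)"
  unfolding bipower_def by (auto intro: hull_inc simp: set_times_def)

lemma bipower_subset_shift:
  assumes "J ^ q \<subseteq> bisum I J K"
  shows "bipower I J (b, q) \<subseteq> bisum I J ((+) (b, 0) ` K)"
  unfolding bipower_def
proof (intro ideal_gen_minimal bisum_ideal)
  have "x * y \<in> bisum I J ((+) (b, 0) ` K)" if "x \<in> I ^ b" "y \<in> J ^ q" for x y
  proof (rule bisum_mult)
    show "x \<in> bipower I J (b, 0)"
      using that(1) unfolding bipower_def by (auto intro: hull_inc simp: set_times_def)
    show "y \<in> bisum I J K" using that(2) assms by blast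
  qed
  then show "I ^ fst (b, q) * J ^ snd (b, q) \<subseteq> bisum I J ((+) (b, 0) ` K)"
    by (auto simp: set_times_def)
qed

text \<open>
  The hypothesis is an equation of integral dependence of \<open>J\<close> over a fractional power of \<open>I\<close>
  with exponent greater than \<open>l\<close>: finitely many exponents occur in it, so the strict inequality leaves
  room for some \<open>l' > l\<close>. It allows every \<open>J ^ m\<close> to be expressed by terms with fewer than
  \<open>q\<close> factors from \<open>J\<close> and the same \<open>l'\<close>-weight, and those lie in the asserted
  power of \<open>I\<close>. The exponents \<open>(b, q)\<close> with \<open>b \<ge> 1\<close>, which keep \<open>J ^
  q\<close> on the right-hand side, are first removed by substituting the equation into itself.
\<close>

lemma power_in_higher_weights_imp_containment:
  fixes I J :: "'a::comm_ring_1 set"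
  assumes noeth: "is_noetherian (UNIV :: 'a set)" and "J \<subseteq> I" and l: "l > 0" and q: "q > 0"
    and J: "J ^ q \<subseteq> bisum I J {m. weight l (0, q) < weight l m}"
  shows "\<exists>l'>l. \<forall>m p. real p \<le> l' * (real m - real q) \<longrightarrow> J ^ m \<subseteq> ideal_gen (I ^ p)"
proof -
  obtain L where L: "finite L" "L \<subseteq> {m. weight l (0, q) < weight l m}" "J ^ q \<subseteq> bisum I J L"
    using bisum_finite_support_ideal[OF noeth J] .
  have "\<forall>\<^sub>F l' in at_right l. \<forall>m\<in>L. weight l' (0, q) < weight l' m"
    using L(1,2) by (intro eventually_ball_finite ballI eventually_weight_less) auto
  moreover have "\<forall>\<^sub>F l' in at_right l. l < l'" by (rule eventually_at_right_less)
  ultimately have "\<forall>\<^sub>F l' in at_right l. l < l' \<and> (\<forall>m\<in>L. weight l' (0, q) < weight l' m)"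
    by eventually_elim simp
  then obtain l' where l': "l < l'" "\<And>m. m \<in> L \<Longrightarrow> weight l' (0, q) < weight l' m"
    using eventually_happens trivial_limit_at_right_real by blast
  define K where "K m = {k. snd k < q \<and> weight l' (0, m) \<le> weight l' k}" for m
  (* N counts how often the equation has been substituted into itself. *)
  have base: "J ^ q \<subseteq> bisum I J ({(b, q) | b. b \<ge> N} \<union> K q)" for N
  proof (induction N)
    case 0
    show ?case
      by (rule subset_bisumI[OF _ power_snd_subset_bipower]) simp
  next
    case (Suc N)
    let ?X = "{(b, q) | b. b \<ge> 1} \<union> K q"
    have "bisum I J L \<subseteq> bisum I J ?X"
    proof (rule bisum_minimal[OF _ bisum_ideal])
      fix k assume k: "k \<in> L"
      show "bipower I J k \<subseteq> bisum I J ?X"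
      proof (cases "snd k < q")
        case True
        then have "k \<in> ?X" using l'(2)[OF k] by (simp add: K_def)
        then show ?thesis by (rule bipower_subset_bisum)
      next
        case False
        have "fst k + snd k - q \<ge> 1"
        proof (cases "snd k = q")
          case True
          then show ?thesis using l'(2)[OF k] by (simp add: weight_def)
        qed (use False in simp)
        then have "(fst k + (snd k - q), q) \<in> ?X" using False by auto
        moreover have "bipower I J k \<subseteq> bipower I J (fst k + (snd k - q), q)"
          using bipower_trade[OF \<open>J \<subseteq> I\<close>, of "snd k - q" "snd k" "fst k"] False by simp
        ultimately show ?thesis by (rule subset_bisumI)
      qed
    qed
    then have step: "J ^ q \<subseteq> bisum I J ?X" using L(3) by blast
    have "bisum I J ({(b, q) | b. b \<ge> N} \<union> K q) \<subseteq> bisum I J ({(b, q) | b. b \<ge> Suc N} \<union> K q)"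
    proof (rule bisum_minimal[OF _ bisum_ideal])
      fix k assume "k \<in> {(b, q) | b. b \<ge> N} \<union> K q"
      then consider b where "k = (b, q)" "b \<ge> N" | "k \<in> K q" by blast
      then show "bipower I J k \<subseteq> bisum I J ({(b, q) | b. b \<ge> Suc N} \<union> K q)"
      proof cases
        case (1 b)
        have "(+) (b, 0) ` ?X \<subseteq> {(b, q) | b. b \<ge> Suc N} \<union> K q"
          using 1(2) by (auto simp: K_def weight_def)
        then show ?thesis
          unfolding 1(1) by (rule subset_bisum_mono[OF _ bipower_subset_shift[OF step]])
      next
        case 2
        then show ?thesis by (intro bipower_subset_bisum) simp
      qed
    qed
    then show ?case using Suc by blast
  qed
  have Kq: "J ^ q \<subseteq> bisum I J (K q)"
  proof -
    (* Once b is at least l' * q, all q factors from J may be traded for factors from I. *)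
    define N where "N = nat \<lceil>l' * real q\<rceil>"
    have "bisum I J ({(b, q) | b. b \<ge> N} \<union> K q) \<subseteq> bisum I J (K q)"
    proof (rule bisum_minimal[OF _ bisum_ideal])
      fix k assume "k \<in> {(b, q) | b. b \<ge> N} \<union> K q"
      then consider b where "k = (b, q)" "b \<ge> N" | "k \<in> K q" by blast
      then show "bipower I J k \<subseteq> bisum I J (K q)"
      proof cases
        case (1 b)
        have "l' * real q \<le> real N" unfolding N_def by linarith
        then have "(b + q, 0) \<in> K q" using 1(2) q by (simp add: K_def weight_def)
        moreover have "bipower I J k \<subseteq> bipower I J (b + q, 0)"
          using bipower_trade[OF \<open>J \<subseteq> I\<close>, of q q b] 1(1) by simp
        ultimately show ?thesis by (rule subset_bisumI)
      next
        case 2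
        then show ?thesis by (rule bipower_subset_bisum)
      qed
    qed
    then show ?thesis using base[of N] by blast
  qed
  have Km: "J ^ m \<subseteq> bisum I J (K m)" for m
  proof (induction m)
    case 0
    have "(0, 0) \<in> K 0" using q by (simp add: K_def)
    then show ?case using power_snd_subset_bipower[of J 0 I] by (rule subset_bisumI)
  next
    case (Suc m)
    have "bisum I J ((+) (0, 1) ` K m) \<subseteq> bisum I J (K (Suc m))"
    proof (rule bisum_minimal[OF _ bisum_ideal])
      fix k assume "k \<in> (+) (0, 1) ` K m"
      then obtain b c where k: "k = (b, Suc c)" "c < q" "weight l' (0, m) \<le> weight l' (b, c)"
        by (auto simp: K_def)
      show "bipower I J k \<subseteq> bisum I J (K (Suc m))"
      proof (cases "Suc c = q")
        case True
        have "(+) (b, 0) ` K q \<subseteq> K (Suc m)"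
          using k(3) True by (auto simp: K_def weight_def algebra_simps)
        then show ?thesis unfolding k(1) True by (rule subset_bisum_mono[OF _ bipower_subset_shift[OF Kq]])
      next
        case False
        then have "k \<in> K (Suc m)" using k by (simp add: K_def weight_def algebra_simps)
        then show ?thesis by (rule bipower_subset_bisum)
      qed
    qed
    moreover have "x * y \<in> bisum I J ((+) (0, 1) ` K m)" if "x \<in> J" "y \<in> J ^ m" for x y
      using that Suc power_snd_subset_bipower[of J 1 I] by (intro bisum_mult) auto
    ultimately show ?case by (auto simp: set_times_def)
  qed
  have "J ^ m \<subseteq> ideal_gen (I ^ p)" if p: "real p \<le> l' * (real m - real q)" for m p
  proof -
    have "bisum I J (K m) \<subseteq> ideal_gen (I ^ p)"
    proof (rule bisum_minimal[OF _ ideal_gen_ideal])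
      fix k assume k: "k \<in> K m"
      have "l' * real (snd k) \<le> l' * real q" using k l'(1) l by (simp add: K_def)
      then have "real p \<le> real (fst k)" using k p by (simp add: K_def weight_def algebra_simps)
      then show "bipower I J k \<subseteq> ideal_gen (I ^ p)"
        using bipower_subset_power[of p "fst k" I J "snd k"] by simp
    qed
    then show ?thesis using Km by blast
  qed
  then show ?thesis using l'(1) by blast
qed

text \<open>
  If \<open>l\<close> were irrational, a containment \<open>J ^ q \<subseteq> I ^ p\<close> of slope close to
  \<open>l\<close> could be pushed to terms of \<open>l\<close>-weight greater than \<open>l * q\<close>, and then
  there would be containments of slope greater than \<open>l\<close>.
\<close>

theorem containment_slope_rational:
  fixes I J :: "'a::comm_ring_1 set"
  assumes noeth: "is_noetherian (UNIV :: 'a set)" and "J \<subseteq> I" and l: "l > 0"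
    and upper: "\<And>q p. q > 0 \<Longrightarrow> J ^ q \<subseteq> ideal_gen (I ^ p) \<Longrightarrow> real p \<le> l * real q"
    and approx: "\<And>l'. l' < l \<Longrightarrow> \<exists>q>0. \<exists>p. J ^ q \<subseteq> ideal_gen (I ^ p) \<and> l' * real q < real p"
  shows "l \<in> \<rat>"
proof (rule ccontr)
  assume irr: "l \<notin> \<rat>"
  have "\<forall>\<^sub>F l' in at_left l. l' < l" by (simp add: eventually_at_filter)
  with higher_stable[OF noeth, of I J l "{..<l}"]
  have "\<forall>\<^sub>F l' in at_left l. l' < l \<and> (\<forall>k.
    higher I J l k \<subseteq> bisum I J {m. weight l k < weight l m \<and> weight l' k < weight l' m})"
    by eventually_elim simp
  then obtain l' where l': "l' < l"
    "\<And>k. higher I J l k \<subseteq> bisum I J {m. weight l k < weight l m \<and> weight l' k < weight l' m}"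
    using eventually_happens trivial_limit_at_left_real by blast
  obtain q p where q: "q > 0" "J ^ q \<subseteq> ideal_gen (I ^ p)" "l' * real q < real p"
    using approx[OF l'(1)] by blast
  have "ideal_gen (I ^ p) \<subseteq> bipower I J (p, 0)"
    unfolding bipower_def by (intro hull_mono) (auto simp: set_times_def)
  then have "J ^ q \<subseteq> bipower I J (p, 0)" using q(2) by (rule subset_trans[rotated])
  moreover have "(p, 0) \<in> {m. weight l' (0, q) < weight l' m}"
    using q(3) by (simp add: weight_def)
  ultimately have "J ^ q \<subseteq> bisum I J {m. weight l' (0, q) < weight l' m}"
    by (rule subset_bisumI[rotated])
  from push_to_higher_weight[OF irr l l'(2) power_snd_subset_bipower this]
  obtain L where L: "L > l" "\<And>m p. real p \<le> L * (real m - real q) \<Longrightarrow> J ^ m \<subseteq> ideal_gen (I ^ p)"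
    using power_in_higher_weights_imp_containment[OF noeth \<open>J \<subseteq> I\<close> l q(1)] by blast
  (* The lower bound on m makes L * (m - q) exceed l * m by more than 1, so that an integer fits in between. *)
  obtain m :: nat where m: "(L * real q + 1) / (L - l) < real m" using reals_Archimedean2 by blast
  then have m': "l * real m < L * (real m - real q) - 1"
    using L(1) by (simp add: divide_less_eq algebra_simps)
  have "(L * real q + 1) / (L - l) > 0" using L(1) l by (intro divide_pos_pos add_nonneg_pos) auto
  then have "m > 0" using m by linarith
  define p' where "p' = nat \<lfloor>L * (real m - real q)\<rfloor>"
  have "0 \<le> l * real m" using l by simp
  then have "real p' \<le> L * (real m - real q)" "l * real m < real p'"
    using m' unfolding p'_def by linarith+
  then show False using upper[OF \<open>m > 0\<close> L(2)[of p' m]] by simp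
qed

section \<open>Resurgence of graded families\<close>

text \<open>
  The asymptotic supremum is the threshold \<open>c\<close> itself. If the other supremum exceeds \<open>c\<close>, it
  is attained: above a fixed \<open>\<beta> > c\<close> only finitely many pairs \<open>(s, r)\<close> violate the
  containment.
\<close>

lemma rational_suprema_from_threshold:
  fixes cont :: "nat \<Rightarrow> nat \<Rightarrow> bool" and c :: real
  assumes c: "c \<in> \<rat>" "0 \<le> c"
    and above: "\<And>\<beta>. c < \<beta> \<Longrightarrow> \<exists>s0. \<forall>s\<ge>s0. \<forall>r. \<beta> * real r \<le> real s \<longrightarrow> cont s r"
    and below: "\<And>\<beta>. 0 \<le> \<beta> \<Longrightarrow> \<beta> < c \<Longrightarrow>
      \<exists>s r. r > 0 \<and> \<beta> < real s / real r \<and> (\<forall>t>0. \<not> cont (s * t) (r * t))"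
  shows "\<exists>x\<in>\<rat>. 0 \<le> x \<and> Sup {ennreal (real s / real r) | s r. \<not> cont s r} = ennreal x"
    and "\<exists>x\<in>\<rat>. 0 \<le> x \<and> Sup {ennreal (real s / real r) | s r.
           \<forall>\<^sub>F t in sequentially. \<not> cont (s * t) (r * t)} = ennreal x"
proof -
  let ?A = "{ennreal (real s / real r) | s r. \<not> cont s r}"
  let ?B = "{ennreal (real s / real r) | s r. \<forall>\<^sub>F t in sequentially. \<not> cont (s * t) (r * t)}"
  have lower: "\<exists>x\<in>?A \<inter> ?B. y < x" if y: "y < ennreal c" for y
  proof -
    obtain \<beta> where \<beta>: "y = ennreal \<beta>" "0 \<le> \<beta>" using y by (cases y) auto
    then have "\<beta> < c" using y by (simp add: ennreal_less_iff)
    then obtain s r where sr: "r > 0" "\<beta> < real s / real r" "\<forall>t>0. \<not> cont (s * t) (r * t)"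
      using below \<beta>(2) by blast
    have "\<not> cont s r" using sr(3)[rule_format, of 1] by simp
    moreover have "\<forall>\<^sub>F t in sequentially. \<not> cont (s * t) (r * t)"
      using eventually_gt_at_top[of 0] by eventually_elim (use sr(3) in blast)
    ultimately have "ennreal (real s / real r) \<in> ?A \<inter> ?B" by blast
    moreover have "y < ennreal (real s / real r)"
      using \<beta> sr(2) by (simp add: ennreal_less_iff)
    ultimately show ?thesis by blast
  qed
  have "Sup ?B \<le> ennreal c"
  proof (rule Sup_least)
    fix x assume "x \<in> ?B"
    then obtain s r where x: "x = ennreal (real s / real r)"
      and ev: "\<forall>\<^sub>F t in sequentially. \<not> cont (s * t) (r * t)" by blast
    show "x \<le> ennreal c"
    proof (rule ccontr)
      assume "\<not> x \<le> ennreal c"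
      then have gt: "c < real s / real r" using c(2) by (simp add: x ennreal_less_iff not_le)
      then have pos: "r > 0" "s > 0" using c(2) by (auto intro!: Nat.gr0I)
      from above[OF gt] obtain s0
        where s0: "\<And>s' r'. s' \<ge> s0 \<Longrightarrow> real s / real r * real r' \<le> real s' \<Longrightarrow> cont s' r'" by blast
      have "\<forall>\<^sub>F t in sequentially. cont (s * t) (r * t)"
        using eventually_ge_at_top[of s0]
      proof eventually_elim
        case (elim t)
        have "t \<le> s * t" using pos(2) by simp
        then have "s0 \<le> s * t" using elim by (rule order_trans[rotated])
        then show ?case using pos by (intro s0) auto
      qed
      with ev have "\<forall>\<^sub>F t::nat in sequentially. False" by eventually_elim simp
      then show False by simp
    qed
  qed
  moreover have "ennreal c \<le> Sup ?B"
    unfolding le_Sup_iff using lower by blast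
  ultimately have "Sup ?B = ennreal c" by (rule antisym)
  then show "\<exists>x\<in>\<rat>. 0 \<le> x \<and> Sup ?B = ennreal x" using c by blast
  have c_le: "ennreal c \<le> Sup ?A"
    unfolding le_Sup_iff using lower by blast
  show "\<exists>x\<in>\<rat>. 0 \<le> x \<and> Sup ?A = ennreal x"
  proof (cases "Sup ?A = ennreal c")
    case True
    then show ?thesis using c by blast
  next
    case False
    then have "ennreal c < Sup ?A" using c_le by order
    then obtain s1 r1 where sr1: "\<not> cont s1 r1" "ennreal c < ennreal (real s1 / real r1)"
      unfolding less_Sup_iff by blast
    define \<beta> where "\<beta> = real s1 / real r1"
    have \<beta>: "c < \<beta>" using sr1(2) c(2) by (simp add: \<beta>_def ennreal_less_iff)
    then have "\<beta> > 0" using c(2) by simp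
    obtain s0 where s0: "\<And>s r. s \<ge> s0 \<Longrightarrow> \<beta> * real r \<le> real s \<Longrightarrow> cont s r"
      using above[OF \<beta>] by blast
    define E where "E = {(s, r). \<not> cont s r \<and> \<beta> \<le> real s / real r}"
    have "E \<subseteq> {..s0} \<times> {..nat \<lceil>real s0 / \<beta>\<rceil>}"
    proof
      fix e assume "e \<in> E"
      then obtain s r where e: "e = (s, r)" "\<not> cont s r" "\<beta> \<le> real s / real r" by (auto simp: E_def)
      then have "r > 0" using \<open>\<beta> > 0\<close> by (auto intro!: Nat.gr0I)
      then have le: "\<beta> * real r \<le> real s" using e(3) by (simp add: le_divide_eq)
      then have "s < s0" using s0[of s r] e(2) by (meson not_le)
      then have "\<beta> * real r \<le> real s0" using le by linarith
      then have "real r \<le> real s0 / \<beta>" using \<open>\<beta> > 0\<close> by (simp add: le_divide_eq mult.commute)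
      then have "r \<le> nat \<lceil>real s0 / \<beta>\<rceil>" by linarith
      then show "e \<in> {..s0} \<times> {..nat \<lceil>real s0 / \<beta>\<rceil>}" using \<open>s < s0\<close> e(1) by simp
    qed
    then have fin: "finite E" by (rule finite_subset) simp
    define Q where "Q = (\<lambda>(s, r). real s / real r) ` E"
    have Q: "finite Q" "\<beta> \<in> Q" using fin sr1(1) by (force simp: Q_def E_def \<beta>_def)+
    have "Max Q \<in> Q" using Q by (intro Max_in) auto
    then obtain s2 r2 where max: "Max Q = real s2 / real r2" "\<not> cont s2 r2"
      by (auto simp: Q_def E_def)
    have "Sup ?A \<le> ennreal (Max Q)"
    proof (rule Sup_least)
      fix x assume "x \<in> ?A"
      then obtain s r where x: "x = ennreal (real s / real r)" "\<not> cont s r" by blast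
      have "real s / real r \<le> Max Q"
      proof (cases "\<beta> \<le> real s / real r")
        case True
        then have "real s / real r \<in> Q" using x(2) by (force simp: Q_def E_def)
        then show ?thesis using Q(1) by simp
      next
        case False
        then show ?thesis using Max_ge[OF Q] by linarith
      qed
      then show "x \<le> ennreal (Max Q)" unfolding x(1) by (rule ennreal_leI)
    qed
    moreover have "ennreal (Max Q) \<le> Sup ?A" using max by (intro Sup_upper) auto
    ultimately have "Sup ?A = ennreal (Max Q)" by (rule antisym)
    moreover have "Max Q \<in> \<rat>" "0 \<le> Max Q" using max(1) by simp_all
    ultimately show ?thesis by blast
  qed
qed

lemma ideal_gen_power:
  assumes "A \<subseteq> ideal_gen B"
  shows "A ^ n \<subseteq> ideal_gen (B ^ n)"
proof (induction n)
  case 0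
  show ?case using hull_subset[of "{1}" is_ideal] by simp
next
  case (Suc n)
  have "x * y \<in> ideal_gen (B * B ^ n)" if "x \<in> A" "y \<in> A ^ n" for x y
    using that assms Suc by (intro ideal_gen_mult) auto
  then show ?case by (auto simp: set_times_def)
qed

lemma ideal_gen_power_antimono:
  assumes "b \<le> a" shows "ideal_gen (I ^ a) \<subseteq> ideal_gen (I ^ b)"
  using bipower_subset_power[OF assms, of I I 0] by (simp add: bipower_def mult_1_right flip: set_one)

text \<open>
  The remaining \<open>j mod q\<close> factors of \<open>J ^ j\<close> are discarded.
\<close>

lemma power_containment_div:
  assumes "J ^ q \<subseteq> ideal_gen (I ^ p)"
  shows "J ^ j \<subseteq> ideal_gen (I ^ (p * (j div q)))"
proof -
  have "J ^ j = (J ^ q) ^ (j div q) * J ^ (j mod q)"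
    by (simp flip: power_mult power_add)
  moreover have "x * y \<in> ideal_gen ((I ^ p) ^ (j div q))"
    if "x \<in> (J ^ q) ^ (j div q)" for x y
    using ideal_gen_power[OF assms, of "j div q"] that
    by (subst mult.commute) (auto intro: is_submodule_mult[OF ideal_gen_ideal])
  ultimately show ?thesis by (auto simp: power_mult elim: set_times_elim)
qed

lemma graded_generated_by_products:
  fixes K :: "nat \<Rightarrow> 'a::comm_ring_1 set"
  assumes gen: "\<And>s. s > 0 \<Longrightarrow> K s \<subseteq> ideal_gen (\<Union>a\<in>{1..min D s}. K a * K (s - a))"
  shows "K s \<subseteq> ideal_gen {prod_list (map snd xs) | xs.
    (\<forall>(a, x)\<in>set xs. a \<in> {1..D} \<and> x \<in> K a) \<and> sum_list (map fst xs) = s}"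
    (is "_ \<subseteq> ideal_gen (?P s)")
proof (induction s rule: less_induct)
  case (less s)
  show ?case
  proof (cases "s = 0")
    case True
    have "prod_list (map snd ([] :: (nat \<times> 'a) list)) \<in> ?P s"
      by (intro CollectI exI[of _ "[]"]) (simp add: True)
    then have "1 \<in> ideal_gen (?P s)" by (simp add: hull_inc)
    then have "x \<in> ideal_gen (?P s)" for x
      using is_submodule_mult[OF ideal_gen_ideal, of x 1] by simp
    then show ?thesis by blast
  next
    case False
    have "x * y \<in> ideal_gen (?P s)" if a: "a \<in> {1..min D s}" and x: "x \<in> K a" and y: "y \<in> K (s - a)" for a x y
    proof -
      have "?P (s - a) \<subseteq> {y. y * x \<in> ideal_gen (?P s)}"
      proof safe
        fix xs :: "(nat \<times> 'a) list"
        assume xs: "\<forall>(a, x)\<in>set xs. a \<in> {1..D} \<and> x \<in> K a" "sum_list (map fst xs) = s - a"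
        have "prod_list (map snd ((a, x) # xs)) \<in> ?P s"
          using xs a x by (intro CollectI exI[of _ "(a, x) # xs"]) auto
        then show "prod_list (map snd xs) * x \<in> ideal_gen (?P s)"
          by (simp add: hull_inc mult.commute)
      qed
      then have "ideal_gen (?P (s - a)) \<subseteq> {y. y * x \<in> ideal_gen (?P s)}"
        by (intro ideal_gen_minimal is_ideal_mult_preimage ideal_gen_ideal)
      moreover have "y \<in> ideal_gen (?P (s - a))" using less[of "s - a"] a y by auto
      ultimately show ?thesis by (auto simp: mult.commute)
    qed
    then have "ideal_gen (\<Union>a\<in>{1..min D s}. K a * K (s - a)) \<subseteq> ideal_gen (?P s)"
      by (intro ideal_gen_minimal ideal_gen_ideal) (auto simp: set_times_def)
    then show ?thesis using gen[of s] False by blast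
  qed
qed

lemma sum_list_fst_eq_sum_counts:
  assumes "\<forall>(a, x)\<in>set xs. a \<in> {1..D::nat}"
  shows "sum_list (map fst xs) = (\<Sum>a=1..D. a * length (filter (\<lambda>p. fst p = a) xs))"
  using assms
proof (induction xs)
  case (Cons p xs)
  have "(\<Sum>a=1..D. a * length (filter (\<lambda>p. fst p = a) (p # xs)))
      = (\<Sum>a=1..D. a * length (filter (\<lambda>p. fst p = a) xs) + (if fst p = a then a else 0))"
    by (intro sum.cong) auto
  also have "\<dots> = sum_list (map fst xs) + fst p"
    using Cons by (auto simp: sum.distrib)
  finally show ?case by simp
qed simp

lemma prod_list_filter_split:
  fixes f :: "'b \<Rightarrow> 'a::comm_monoid_mult"
  shows "prod_list (map f xs) = prod_list (map f (filter P xs)) * prod_list (map f (filter (\<lambda>x. \<not> P x) xs))"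
  by (induction xs) (auto simp: ac_simps)

lemma sum_list_filter_split:
  fixes f :: "'b \<Rightarrow> 'a::comm_monoid_add"
  shows "sum_list (map f xs) = sum_list (map f (filter P xs)) + sum_list (map f (filter (\<lambda>x. \<not> P x) xs))"
  by (induction xs) (auto simp: ac_simps)

text \<open>
  By the pigeonhole principle some degree \<open>a\<close> occurs so often that its elements contribute at least
  \<open>fact D\<close> to the total degree. As \<open>a\<close> divides \<open>fact D\<close>, some of them can be
  grouped to a factor of degree exactly \<open>fact D\<close>.
\<close>

lemma products_in_veronese_power:
  fixes K :: "nat \<Rightarrow> 'a::comm_ring_1 set"
  assumes K0: "1 \<in> K 0" and K_mult: "\<And>a b x y. x \<in> K a \<Longrightarrow> y \<in> K b \<Longrightarrow> x * y \<in> K (a + b)"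
    and "\<forall>(a, x)\<in>set xs. a \<in> {1..D} \<and> x \<in> K a"
    and "sum_list (map fst xs) \<ge> fact D * (j + D)"
  shows "prod_list (map snd xs) \<in> ideal_gen (K (fact D) ^ j)"
  using assms(3,4)
proof (induction j arbitrary: xs)
  case 0
  have "1 \<in> ideal_gen (K (fact D) ^ 0)" by (simp add: hull_inc)
  then show ?case using is_submodule_mult[OF ideal_gen_ideal, of _ 1] by (metis UNIV_I mult.right_neutral)
next
  case (Suc j)
  have "\<exists>a\<in>{1..D}. fact D \<le> a * length (filter (\<lambda>p. fst p = a) xs)"
  proof (rule ccontr)
    assume "\<not> ?thesis"
    then have "(\<Sum>a=1..D. a * length (filter (\<lambda>p. fst p = a) xs)) \<le> (\<Sum>a=1..D. fact D)"
      by (intro sum_mono) force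
    then have "sum_list (map fst xs) \<le> fact D * D"
      using sum_list_fst_eq_sum_counts[of xs D] Suc.prems(1) by (simp add: mult.commute case_prod_beta)
    moreover have "fact D * D < (fact D :: nat) * (Suc j + D)" by (rule mult_less_mono2) auto
    ultimately show False using Suc.prems(2) by linarith
  qed
  then obtain a where a: "a \<in> {1..D}" "fact D \<le> a * length (filter (\<lambda>p. fst p = a) xs)" by blast
  define n where "n = fact D div a"
  have "a dvd fact D" using a(1) by (intro dvd_fact) auto
  then have n: "n * a = fact D" by (simp add: n_def)
  define ys where "ys = filter (\<lambda>p. fst p = a) xs"
  define zs where "zs = drop n ys @ filter (\<lambda>p. fst p \<noteq> a) xs"
  have ys: "set ys \<subseteq> set xs" "\<forall>p\<in>set ys. fst p = a" by (auto simp: ys_def)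
  have len: "n \<le> length ys" using a n by (simp add: ys_def mult.commute flip: n)
  have split: "take n ys @ drop n ys = ys" by simp
  have "prod_list (map snd xs) = prod_list (map snd (take n ys @ drop n ys)) * prod_list (map snd (filter (\<lambda>p. fst p \<noteq> a) xs))"
    unfolding split unfolding ys_def by (rule prod_list_filter_split)
  then have prod: "prod_list (map snd xs) = prod_list (map snd (take n ys)) * prod_list (map snd zs)"
    by (simp add: zs_def mult.assoc del: append_take_drop_id)
  have "sum_list (map fst xs) = sum_list (map fst (take n ys @ drop n ys)) + sum_list (map fst (filter (\<lambda>p. fst p \<noteq> a) xs))"
    unfolding split unfolding ys_def by (rule sum_list_filter_split)
  then have sum: "sum_list (map fst xs) = sum_list (map fst (take n ys)) + sum_list (map fst zs)"
    by (simp add: zs_def add.assoc del: append_take_drop_id)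
  have same: "sum_list (map fst us) = length us * a" if "\<forall>p\<in>set us. fst p = a" for us :: "(nat \<times> 'a) list"
    using that by (induction us) auto
  have take_sub: "set (take n ys) \<subseteq> set ys" by (rule set_take_subset)
  have "sum_list (map fst (take n ys)) = fact D"
    using same[of "take n ys"] ys(2) take_sub len n by auto
  then have "sum_list (map fst zs) \<ge> fact D * (j + D)" using sum Suc.prems(2) by simp
  moreover have zs_sub: "set zs \<subseteq> set xs"
    unfolding zs_def using ys(1) set_drop_subset[of n ys] by auto
  ultimately have "prod_list (map snd zs) \<in> ideal_gen (K (fact D) ^ j)"
    using Suc.prems(1) by (intro Suc.IH) auto
  moreover have "prod_list (map snd us) \<in> K (sum_list (map fst us))" if "set us \<subseteq> set xs" for us
    using that
  proof (induction us)
    case Nil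
    then show ?case using K0 by simp
  next
    case (Cons p us)
    then show ?case using K_mult Suc.prems(1) by (cases p) auto
  qed
  from this[of "take n ys"] have "prod_list (map snd (take n ys)) \<in> K (fact D)"
    using take_sub ys(1) \<open>sum_list (map fst (take n ys)) = fact D\<close> by (simp add: subset_trans)
  ultimately show ?case unfolding prod power_Suc
    by (intro ideal_gen_mult) (simp_all add: hull_inc)
qed

text \<open>
  With \<open>J = K (fact D)\<close> the family \<open>K\<close> differs from the powers of \<open>J\<close> by a
  bounded shift. So the threshold is \<open>fact D / l\<close> for the supremum \<open>l\<close> of the slopes of
  containments \<open>J ^ q \<subseteq> I ^ p\<close>, and \<open>0\<close> if the slopes are unbounded.
\<close>

theorem resurgence_rational_of_graded_family:
  fixes I :: "'a::comm_ring_1 set" and K :: "nat \<Rightarrow> 'a set"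
  assumes noeth: "is_noetherian (UNIV :: 'a set)"
    and K0: "1 \<in> K 0" and K_mult: "\<And>a b x y. x \<in> K a \<Longrightarrow> y \<in> K b \<Longrightarrow> x * y \<in> K (a + b)"
    and K_sub: "\<And>s. s > 0 \<Longrightarrow> K s \<subseteq> I"
    and gen: "\<And>s. s > 0 \<Longrightarrow> K s \<subseteq> ideal_gen (\<Union>a\<in>{1..min D s}. K a * K (s - a))"
  shows "\<exists>x\<in>\<rat>. 0 \<le> x \<and> Sup {ennreal (real s / real r) | s r. \<not> K s \<subseteq> ideal_gen (I ^ r)} = ennreal x"
    and "\<exists>x\<in>\<rat>. 0 \<le> x \<and> Sup {ennreal (real s / real r) | s r.
           \<forall>\<^sub>F t in sequentially. \<not> K (s * t) \<subseteq> ideal_gen (I ^ (r * t))} = ennreal x"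
proof -
  define N :: nat where "N = fact D"
  define J where "J = K N"
  have N: "N > 0" by (simp add: N_def)
  have J_sub: "J \<subseteq> I" unfolding J_def using K_sub[OF N] .
  have K_J: "K s \<subseteq> ideal_gen (J ^ j)" if "N * (j + D) \<le> s" for s j
  proof -
    have "ideal_gen {prod_list (map snd xs) | xs.
      (\<forall>(a, x)\<in>set xs. a \<in> {1..D} \<and> x \<in> K a) \<and> sum_list (map fst xs) = s} \<subseteq> ideal_gen (J ^ j)"
      using that products_in_veronese_power[of K _ D j, OF K0 K_mult] unfolding J_def N_def
      by (intro ideal_gen_minimal ideal_gen_ideal) auto
    then show ?thesis using graded_generated_by_products[of K D s, OF gen] by blast
  qed
  have J_K: "J ^ j \<subseteq> K (N * j)" for j
  proof (induction j)
    case 0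
    show ?case using K0 by simp
  next
    case (Suc j)
    then show ?case using K_mult[of _ N _ "N * j"] by (auto simp: J_def set_times_def)
  qed
  define S where "S = {real p / real q | p q. q > 0 \<and> J ^ q \<subseteq> ideal_gen (I ^ p)}"
  have "J ^ 1 \<subseteq> ideal_gen (I ^ 1)" unfolding power_one_right using J_sub hull_subset[of I is_ideal] by (rule subset_trans)
  then have one_S: "1 \<in> S" unfolding S_def by (intro CollectI exI[of _ 1]) simp
  have above: "\<exists>s0. \<forall>s\<ge>s0. \<forall>r. \<beta> * real r \<le> real s \<longrightarrow> K s \<subseteq> ideal_gen (I ^ r)"
    if \<beta>: "\<beta> > 0" and v: "v \<in> S" "real N < \<beta> * v" for \<beta> v
  proof -
    obtain p q where pq: "v = real p / real q" "q > 0" "J ^ q \<subseteq> ideal_gen (I ^ p)"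
      using v(1) by (auto simp: S_def)
    (* The containments of slope v give an exponent of at least s * v / N - C, where C collects the
       losses from rounding s to a multiple of N, from the shift D and from rounding to a multiple of q;
       r is at most s / \<beta>, and \<epsilon> is the gain per unit of s. *)
    define \<epsilon> where "\<epsilon> = v / real N - 1 / \<beta>"
    have "\<epsilon> > 0" using v(2) \<beta> N by (simp add: \<epsilon>_def field_simps)
    define C where "C = v * (real D + 1) + real p"
    obtain s1 :: nat where s1: "C / \<epsilon> \<le> real s1" using real_arch_simple by blast
    have "K s \<subseteq> ideal_gen (I ^ r)" if s: "s \<ge> max (N * D) s1" "\<beta> * real r \<le> real s" for s r
    proof -
      define j where "j = s div N - D"
      have "D \<le> s div N" using s(1) N by (simp add: less_eq_div_iff_mult_less_eq mult.commute)
      then have j: "j + D = s div N" by (simp add: j_def)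
      then have "N * (j + D) \<le> s" by simp
      then have "K s \<subseteq> ideal_gen (J ^ j)" by (rule K_J)
      also have "\<dots> \<subseteq> ideal_gen (I ^ (p * (j div q)))"
        using power_containment_div[OF pq(3), of j] by (intro ideal_gen_minimal ideal_gen_ideal)
      also have "\<dots> \<subseteq> ideal_gen (I ^ r)"
      proof (rule ideal_gen_power_antimono)
        have div_ge: "real a / real b - 1 \<le> real (a div b)" if "b > 0" for a b :: nat
          using floor_divide_of_nat_eq[of a b, where ?'a = real] by linarith
        have "real r \<le> real s / \<beta>" using s(2) \<beta> by (simp add: le_divide_eq mult.commute)
        also have "\<dots> = v * (real s / real N) - \<epsilon> * real s" by (simp add: \<epsilon>_def algebra_simps)
        also have "\<dots> \<le> v * (real s / real N) - C"
        proof -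
          have "C / \<epsilon> \<le> real s" using s1 s(1) by linarith
          then have "C \<le> \<epsilon> * real s" using \<open>\<epsilon> > 0\<close> by (simp add: divide_le_eq mult.commute)
          then show ?thesis by linarith
        qed
        also have "\<dots> = v * (real s / real N - 1 - real D) - real p" by (simp add: C_def algebra_simps)
        also have "\<dots> \<le> v * real j - real p"
        proof -
          have "real j = real (s div N) - real D" using j by linarith
          then have "real s / real N - 1 - real D \<le> real j" using div_ge[OF N, of s] by linarith
          then have "v * (real s / real N - 1 - real D) \<le> v * real j"
            by (rule mult_left_mono) (simp add: pq(1))
          then show ?thesis by linarith
        qed
        also have "\<dots> = real p * (real j / real q - 1)" by (simp add: pq(1) algebra_simps)
        also have "\<dots> \<le> real p * real (j div q)" by (intro mult_left_mono div_ge pq(2)) simp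
        finally have "real r \<le> real (p * (j div q))" by simp
        then show "r \<le> p * (j div q)" by (simp only: of_nat_le_iff)
      qed
      finally show ?thesis .
    qed
    then show ?thesis by blast
  qed
  have "\<exists>c\<in>\<rat>. 0 \<le> c \<and>
    (\<forall>\<beta>>c. \<exists>v\<in>S. real N < \<beta> * v) \<and>
    (\<forall>\<beta>. 0 \<le> \<beta> \<longrightarrow> \<beta> < c \<longrightarrow>
      (\<exists>s r. r > 0 \<and> \<beta> < real s / real r \<and> (\<forall>t>0. \<not> K (s * t) \<subseteq> ideal_gen (I ^ (r * t)))))"
  proof (cases "bdd_above S")
    case False
    have "\<exists>v\<in>S. real N < \<beta> * v" if "\<beta> > 0" for \<beta>
    proof -
      obtain v where "v \<in> S" "real N / \<beta> < v" using False by (auto simp: bdd_above_def not_le)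
      then show ?thesis using that by (auto simp: divide_less_eq mult.commute)
    qed
    then show ?thesis by (intro bexI[of _ 0]) auto
  next
    case True
    define l where "l = Sup S"
    have l_upper: "v \<le> l" if "v \<in> S" for v unfolding l_def using that True by (rule cSup_upper)
    have l: "l > 0" using l_upper[OF one_S] by simp
    have l_less: "\<exists>v\<in>S. l' < v" if "l' < l" for l'
      using that less_cSup_iff[of S l'] True one_S unfolding l_def by blast
    have "l \<in> \<rat>"
    proof (rule containment_slope_rational[OF noeth J_sub l])
      fix q p :: nat assume "q > 0" "J ^ q \<subseteq> ideal_gen (I ^ p)"
      then have "real p / real q \<in> S" by (auto simp: S_def)
      then have "real p / real q \<le> l" by (rule l_upper)
      then show "real p \<le> l * real q" using \<open>q > 0\<close> by (simp add: divide_le_eq)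
    next
      fix l' assume "l' < l"
      then obtain v where "v \<in> S" "l' < v" using l_less by blast
      then obtain p q where pq: "q > 0" "J ^ q \<subseteq> ideal_gen (I ^ p)" "l' < real p / real q"
        unfolding S_def by blast
      then have "l' * real q < real p" by (simp add: less_divide_eq)
      then show "\<exists>q>0. \<exists>p. J ^ q \<subseteq> ideal_gen (I ^ p) \<and> l' * real q < real p"
        using pq(1,2) by blast
    qed
    have "\<exists>v\<in>S. real N < \<beta> * v" if \<beta>: "\<beta> > real N / l" for \<beta>
    proof -
      have "real N / l > 0" using l N by simp
      then have "\<beta> > 0" using \<beta> by linarith
      then have "real N / \<beta> < l" using \<beta> l by (simp add: divide_less_eq mult.commute)
      then obtain v where "v \<in> S" "real N / \<beta> < v" using l_less by blast
      then show ?thesis using \<open>\<beta> > 0\<close> by (auto simp: divide_less_eq mult.commute)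
    qed
    moreover have "\<exists>s r. r > 0 \<and> \<beta> < real s / real r \<and> (\<forall>t>0. \<not> K (s * t) \<subseteq> ideal_gen (I ^ (r * t)))"
      if \<beta>: "0 \<le> \<beta>" "\<beta> < real N / l" for \<beta>
    proof -
      have "\<beta> * l < real N" using \<beta>(2) l by (simp add: less_divide_eq)
      (* u is chosen so that every w strictly between l and u satisfies \<beta> * w < N. *)
      define u where "u = l + (real N - \<beta> * l) / (\<beta> + 1)"
      have "l < u" using \<open>\<beta> * l < real N\<close> \<beta>(1) by (simp add: u_def)
      then obtain w where w: "w \<in> \<rat>" "l < w" "w < u" using Rats_dense_in_real by blast
      obtain r s' :: nat where rs: "s' \<noteq> 0" "\<bar>w\<bar> = real r / real s'"
        using Rats_abs_nat_div_natE[OF w(1)] by metis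
      then have w_eq: "w = real r / real s'" using w(2) l by simp
      have "r > 0" using w(2) l by (auto simp: w_eq intro!: Nat.gr0I)
      have "(\<beta> + 1) * (w - l) < real N - \<beta> * l"
        using w(3) \<beta>(1) by (simp add: u_def less_divide_eq field_simps)
      moreover have "(\<beta> + 1) * (w - l) = \<beta> * w - \<beta> * l + (w - l)" by (simp add: algebra_simps)
      ultimately have "\<beta> * w < real N" using w(2) by linarith
      then have "\<beta> * real r < real N * real s'" using rs(1) by (simp add: w_eq field_simps)
      then have "\<beta> < real (N * s') / real r" using \<open>r > 0\<close> by (simp add: less_divide_eq)
      moreover have "\<not> K (N * s' * t) \<subseteq> ideal_gen (I ^ (r * t))" if t: "t > 0" for t
      proof
        assume "K (N * s' * t) \<subseteq> ideal_gen (I ^ (r * t))"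
        then have "J ^ (s' * t) \<subseteq> ideal_gen (I ^ (r * t))" using J_K[of "s' * t"] by (auto simp: mult.assoc)
        moreover have "s' * t > 0" using rs(1) t by simp
        ultimately have "real (r * t) / real (s' * t) \<in> S" unfolding S_def by blast
        then have "w \<le> l" using l_upper[of "real (r * t) / real (s' * t)"] t by (simp add: w_eq)
        then show False using w(2) by simp
      qed
      ultimately show ?thesis using \<open>r > 0\<close> by blast
    qed
    moreover have "real N / l \<in> \<rat>" "0 \<le> real N / l" using \<open>l \<in> \<rat>\<close> l by simp_all
    ultimately show ?thesis by blast
  qed
  then obtain c where c: "c \<in> \<rat>" "0 \<le> c" "\<And>\<beta>. \<beta> > c \<Longrightarrow> \<exists>v\<in>S. real N < \<beta> * v"
    "\<And>\<beta>. 0 \<le> \<beta> \<Longrightarrow> \<beta> < c \<Longrightarrow>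
      \<exists>s r. r > 0 \<and> \<beta> < real s / real r \<and> (\<forall>t>0. \<not> K (s * t) \<subseteq> ideal_gen (I ^ (r * t)))"
    by blast
  have c_above: "\<exists>s0. \<forall>s\<ge>s0. \<forall>r. \<beta> * real r \<le> real s \<longrightarrow> K s \<subseteq> ideal_gen (I ^ r)" if "c < \<beta>" for \<beta>
    using above[of \<beta>] c(3)[OF that] c(2) that by auto
  show "\<exists>x\<in>\<rat>. 0 \<le> x \<and> Sup {ennreal (real s / real r) | s r. \<not> K s \<subseteq> ideal_gen (I ^ r)} = ennreal x"
    and "\<exists>x\<in>\<rat>. 0 \<le> x \<and> Sup {ennreal (real s / real r) | s r.
           \<forall>\<^sub>F t in sequentially. \<not> K (s * t) \<subseteq> ideal_gen (I ^ (r * t))} = ennreal x"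
    using rational_suprema_from_threshold[of c "\<lambda>s r. K s \<subseteq> ideal_gen (I ^ r)", OF c(1,2) c_above c(4)]
    by blast+
qed

section \<open>Ideals of a type-class ring in locale terms\<close>

abbreviation type_ring :: "'a::comm_ring_1 ring"
  where "type_ring \<equiv> ring_of_type_algebra"

lemma type_ring_simps [simp]:
  "carrier type_ring = UNIV" "monoid.mult type_ring = (*)" "one type_ring = 1"
  "ring.zero type_ring = 0" "add type_ring = (+)"
  by (auto simp: ring_of_type_algebra_def fun_eq_iff)

interpretation type_ring: cring "type_ring :: 'a::comm_ring_1 ring"
  by (rule cring_from_type_algebra)

lemma type_ring_a_inv [simp]: "\<ominus>\<^bsub>type_ring\<^esub> x = - x"
  using type_ring.minus_equality[of "- x" x] by simp

lemma type_ring_minus [simp]: "x \<ominus>\<^bsub>type_ring\<^esub> y = x - y"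
  by (simp add: a_minus_def)

lemma type_ring_finsum [simp]: "finite A \<Longrightarrow> finsum type_ring f A = sum f A"
  by (induction A rule: finite_induct) (simp_all add: type_ring.finsum_insert)

text \<open>
  In a ring with one, closure under additive inverses follows from closure under multiplication by \<open>\<ominus>
  \<one>\<close>.
\<close>

lemma (in ring) idealI_closed:
  assumes "T \<subseteq> carrier R" "\<zero> \<in> T" "\<And>x y. x \<in> T \<Longrightarrow> y \<in> T \<Longrightarrow> x \<oplus> y \<in> T"
    "\<And>a x. a \<in> carrier R \<Longrightarrow> x \<in> T \<Longrightarrow> a \<otimes> x \<in> T"
    "\<And>a x. a \<in> carrier R \<Longrightarrow> x \<in> T \<Longrightarrow> x \<otimes> a \<in> T"
  shows "ideal T R"
proof (rule idealI)
  have "\<ominus> x \<in> T" if "x \<in> T" for x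
  proof -
    have "\<ominus> x = (\<ominus> \<one>) \<otimes> x" using assms(1) that by (auto simp: l_minus)
    then show ?thesis using assms(4)[of "\<ominus> \<one>" x] that by simp
  qed
  then show "subgroup T (add_monoid R)"
    using assms by (intro add.subgroupI) (auto simp: a_inv_def)
qed (use assms ring_axioms in auto)

lemma ideal_type_ring_iff: "ideal T type_ring \<longleftrightarrow> is_ideal T"
proof
  assume "ideal T type_ring"
  then interpret ideal T type_ring .
  show "is_ideal T"
    unfolding is_submodule_def
    using zero_closed a_closed I_l_closed by simp
next
  assume "is_ideal T"
  then show "ideal T type_ring"
    by (intro type_ring.idealI_closed) (auto simp: is_submodule_def mult.commute)
qed

lemma ideal_prod_type_ring:
  assumes "is_ideal A" "is_ideal B"
  shows "ideal_prod type_ring A B = ideal_gen (A * B)"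
proof
  show "ideal_prod type_ring A B \<subseteq> ideal_gen (A * B)"
  proof
    fix x assume "x \<in> ideal_prod type_ring A B"
    then show "x \<in> ideal_gen (A * B)"
      by (induction rule: ideal_prod.induct)
        (auto intro: hull_inc is_submodule_add[OF ideal_gen_ideal])
  qed
  have "is_ideal (ideal_prod type_ring A B)"
    using type_ring.ideal_prod_is_ideal assms unfolding ideal_type_ring_iff by blast
  then show "ideal_gen (A * B) \<subseteq> ideal_prod type_ring A B"
    using ideal_prod.prod[of _ A _ B type_ring]
    by (intro ideal_gen_minimal) (auto simp: set_times_def)
qed

lemma ideal_power_type_ring:
  assumes "is_ideal I"
  shows "ideal_power type_ring (I :: 'a::comm_ring_1 set) n = ideal_gen (I ^ n)"
proof (induction n)
  case 0
  have "a * 1 \<in> ideal_gen {1}" for a :: 'a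
    by (intro is_submodule_mult[OF ideal_gen_ideal] UNIV_I hull_inc) simp
  then have "ideal_gen ({1} :: 'a set) = UNIV" by auto
  then show ?case by (simp add: ideal_power_def ideals_set_def)
next
  case (Suc n)
  interpret S: comm_monoid "ideals_set type_ring" by (rule type_ring.ideals_set_is_comm_monoid)
  have "ideal_power type_ring I (Suc n) = ideal_prod type_ring (ideal_gen (I ^ n)) I"
    using Suc by (simp add: ideal_power_def ideals_set_def)
  also have "\<dots> = ideal_gen (ideal_gen (I ^ n) * I)"
    by (intro ideal_prod_type_ring ideal_gen_ideal assms)
  also have "\<dots> = ideal_gen (I ^ Suc n)"
  proof
    have "x * y \<in> ideal_gen (I ^ n * I)" if "x \<in> ideal_gen (I ^ n)" "y \<in> I" for x y
      using that by (intro ideal_gen_mult) (auto intro: hull_inc)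
    then show "ideal_gen (ideal_gen (I ^ n) * I) \<subseteq> ideal_gen (I ^ Suc n)"
      unfolding power_Suc2 by (intro ideal_gen_minimal ideal_gen_ideal) (auto elim: set_times_elim)
    show "ideal_gen (I ^ Suc n) \<subseteq> ideal_gen (ideal_gen (I ^ n) * I)"
      unfolding power_Suc2 by (intro hull_mono set_times_mono2 hull_subset subset_refl)
  qed
  finally show ?case .
qed

lemma associated_primes_type_ring:
  assumes "is_ideal I"
  shows "P \<in> associated_primes type_ring I \<longleftrightarrow> primeideal P type_ring \<and> (\<exists>y. P = {a. a * y \<in> I})"
proof -
  interpret ideal I type_ring using assms by (simp add: ideal_type_ring_iff)
  have eq: "I +>\<^bsub>type_ring\<^esub> a = I \<longleftrightarrow> a \<in> I" for a
    using type_ring.a_rcos_zero[OF is_ideal, of a] rcos_const_imp_mem[of a] by auto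
  have carr: "carrier (type_ring Quot I) = range (\<lambda>y. I +>\<^bsub>type_ring\<^esub> y)"
    by (auto simp: FactRing_def A_RCOSETS_def')
  have mult: "(I +>\<^bsub>type_ring\<^esub> a) \<otimes>\<^bsub>type_ring Quot I\<^esub> (I +>\<^bsub>type_ring\<^esub> y) = I +>\<^bsub>type_ring\<^esub> (a * y)" for a y
    using rcoset_mult_add[of a y] by (simp add: FactRing_def)
  have zero: "\<zero>\<^bsub>type_ring Quot I\<^esub> = I" by (simp add: FactRing_def)
  show ?thesis unfolding associated_primes_def carr by (simp add: mult zero eq)
qed

section \<open>Localization\<close>

lemma UN_pairs_const:
  assumes "\<And>a s b t. (a, s) \<in> A \<Longrightarrow> (b, t) \<in> B \<Longrightarrow> g a s b t = c" "p \<in> A" "q \<in> B"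
  shows "(\<Union>(a, s)\<in>A. \<Union>(b, t)\<in>B. g a s b t) = c"
proof -
  have "(\<Union>(a, s)\<in>A. \<Union>(b, t)\<in>B. g a s b t) = (\<Union>x\<in>A. \<Union>y\<in>B. c)"
    using assms(1) by (intro SUP_cong refl) (auto simp: case_prod_beta)
  then show ?thesis using assms(2,3) by auto
qed

definition is_multiplicative :: "'a::comm_ring_1 set \<Rightarrow> bool"
  where "is_multiplicative S \<longleftrightarrow> 1 \<in> S \<and> (\<forall>x\<in>S. \<forall>y\<in>S. x * y \<in> S)"

context
  fixes S :: "'a::comm_ring_1 set"
  assumes S: "is_multiplicative S"
begin

lemma one_S: "1 \<in> S" and mult_S: "x \<in> S \<Longrightarrow> y \<in> S \<Longrightarrow> x * y \<in> S"
  using S by (auto simp: is_multiplicative_def)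

lemma frac_rel_iff:
  "((a, s), (b, t)) \<in> frac_rel type_ring S \<longleftrightarrow> s \<in> S \<and> t \<in> S \<and> (\<exists>u\<in>S. u * (a * t - b * s) = 0)"
  by (auto simp: frac_rel_def)

lemma equiv_frac_rel: "equiv (UNIV \<times> S) (frac_rel type_ring S)"
proof (rule equivI)
  show "frac_rel type_ring S \<subseteq> (UNIV \<times> S) \<times> (UNIV \<times> S)" by (auto simp: frac_rel_def)
  show "refl_on (UNIV \<times> S) (frac_rel type_ring S)"
    using one_S by (auto simp: refl_on_def frac_rel_iff)
  show "sym (frac_rel type_ring S)"
  proof (rule symI, clarify)
    fix a s b t assume "((a, s), (b, t)) \<in> frac_rel type_ring S"
    then obtain u where "s \<in> S" "t \<in> S" "u \<in> S" "u * (a * t - b * s) = 0" by (auto simp: frac_rel_iff)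
    moreover from this have "u * (b * s - a * t) = 0" by (simp add: algebra_simps)
    ultimately show "((b, t), (a, s)) \<in> frac_rel type_ring S" by (auto simp: frac_rel_iff)
  qed
  show "trans (frac_rel type_ring S)"
  proof (rule transI, clarify)
    fix a s b t c w assume "((a, s), (b, t)) \<in> frac_rel type_ring S" "((b, t), (c, w)) \<in> frac_rel type_ring S"
    then obtain u v where *: "s \<in> S" "t \<in> S" "w \<in> S" "u \<in> S" "v \<in> S"
      "u * (a * t - b * s) = 0" "v * (b * w - c * t) = 0" by (auto simp: frac_rel_iff)
    have "(u * v * t) * (a * w - c * s) = v * w * (u * (a * t - b * s)) + u * s * (v * (b * w - c * t))"
      by (simp add: algebra_simps)
    then have "(u * v * t) * (a * w - c * s) = 0" using * by simp
    then show "((a, s), (c, w)) \<in> frac_rel type_ring S"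
      using * mult_S unfolding frac_rel_iff by blast
  qed
qed

abbreviation frc :: "'a \<Rightarrow> 'a \<Rightarrow> ('a \<times> 'a) set"
  where "frc \<equiv> fraction type_ring S"

abbreviation loc_ring :: "('a \<times> 'a) set ring"
  where "loc_ring \<equiv> fraction_ring type_ring S"

lemma frc_eq_iff:
  assumes "s \<in> S" "t \<in> S"
  shows "frc a s = frc b t \<longleftrightarrow> (\<exists>u\<in>S. u * (a * t - b * s) = 0)"
  unfolding fraction_def
  using eq_equiv_class_iff[OF equiv_frac_rel, of "(a, s)" "(b, t)"] assms by (simp add: frac_rel_iff)

lemma frc_eqI: "s \<in> S \<Longrightarrow> t \<in> S \<Longrightarrow> a * t = b * s \<Longrightarrow> frc a s = frc b t"
  using one_S by (subst frc_eq_iff) (auto intro!: bexI[of _ 1])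

lemma loc_carrier: "carrier loc_ring = {frc a s | a s. s \<in> S}"
  by (auto simp: fraction_ring_def quotient_def fraction_def)

lemma frc_carrier: "s \<in> S \<Longrightarrow> frc a s \<in> carrier loc_ring"
  by (auto simp: loc_carrier)

lemma loc_carrierE:
  assumes "x \<in> carrier loc_ring"
  obtains a s where "x = frc a s" "s \<in> S"
  using assms by (auto simp: loc_carrier)

lemma mem_frc: "(b, t) \<in> frc a s \<longleftrightarrow> s \<in> S \<and> t \<in> S \<and> (\<exists>u\<in>S. u * (a * t - b * s) = 0)"
  by (simp add: fraction_def frac_rel_iff)

lemma loc_mult:
  assumes "s \<in> S" "t \<in> S"
  shows "frc a s \<otimes>\<^bsub>loc_ring\<^esub> frc b t = frc (a * b) (s * t)"
proof -
  have "frc (a' * b') (s' * t') = frc (a * b) (s * t)" if "(a', s') \<in> frc a s" "(b', t') \<in> frc b t" for a' s' b' t'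
  proof -
    note pre = that
    obtain u v where *: "s' \<in> S" "t' \<in> S" "u \<in> S" "v \<in> S" "u * (a * s' - a' * s) = 0" "v * (b * t' - b' * t) = 0"
      using pre unfolding mem_frc by blast
    have "(u * v) * (a' * b' * (s * t) - a * b * (s' * t')) =
      - (v * b' * t) * (u * (a * s' - a' * s)) - u * a * s' * (v * (b * t' - b' * t))"
      by (simp add: algebra_simps)
    also have "\<dots> = 0" using * by simp
    finally show ?thesis using * assms mult_S by (subst frc_eq_iff) blast+
  qed
  moreover have "(a, s) \<in> frc a s" "(b, t) \<in> frc b t"
    using assms one_S by (auto simp: mem_frc)
  ultimately have "(\<Union>(a', s')\<in>frc a s. \<Union>(b', t')\<in>frc b t. frc (a' * b') (s' * t')) = frc (a * b) (s * t)"
    by (intro UN_pairs_const)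
  then show ?thesis by (simp add: fraction_ring_def)
qed

lemma loc_add:
  assumes "s \<in> S" "t \<in> S"
  shows "frc a s \<oplus>\<^bsub>loc_ring\<^esub> frc b t = frc (a * t + b * s) (s * t)"
proof -
  have "frc (a' * t' + b' * s') (s' * t') = frc (a * t + b * s) (s * t)"
    if "(a', s') \<in> frc a s" "(b', t') \<in> frc b t" for a' s' b' t'
  proof -
    note pre = that
    obtain u v where *: "s' \<in> S" "t' \<in> S" "u \<in> S" "v \<in> S" "u * (a * s' - a' * s) = 0" "v * (b * t' - b' * t) = 0"
      using pre unfolding mem_frc by blast
    have "(u * v) * ((a' * t' + b' * s') * (s * t) - (a * t + b * s) * (s' * t')) =
      - (v * t * t') * (u * (a * s' - a' * s)) - u * s * s' * (v * (b * t' - b' * t))"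
      by (simp add: algebra_simps)
    also have "\<dots> = 0" using * by simp
    finally show ?thesis using * assms mult_S by (subst frc_eq_iff) blast+
  qed
  moreover have "(a, s) \<in> frc a s" "(b, t) \<in> frc b t"
    using assms one_S by (auto simp: mem_frc)
  ultimately have "(\<Union>(a', s')\<in>frc a s. \<Union>(b', t')\<in>frc b t. frc (a' * t' + b' * s') (s' * t')) = frc (a * t + b * s) (s * t)"
    by (intro UN_pairs_const)
  then show ?thesis by (simp add: fraction_ring_def)
qed

lemma loc_zero: "\<zero>\<^bsub>loc_ring\<^esub> = frc 0 1" and loc_one: "\<one>\<^bsub>loc_ring\<^esub> = frc 1 1"
  by (simp_all add: fraction_ring_def)

text \<open>
  An ideal generated by a set is an intersection over \<open>ideal\<close>, a locale that includes the ring axioms, so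
  they have to be verified before extended ideals can be described.
\<close>

lemma loc_cring: "cring loc_ring"
proof (rule cringI)
  note simps = frc_carrier loc_mult loc_add loc_zero loc_one one_S mult_S
  show "abelian_group loc_ring"
  proof (rule abelian_groupI)
    show "\<exists>y\<in>carrier loc_ring. y \<oplus>\<^bsub>loc_ring\<^esub> x = \<zero>\<^bsub>loc_ring\<^esub>" if "x \<in> carrier loc_ring" for x
    proof -
      obtain a s where "x = frc a s" "s \<in> S" using \<open>x \<in> carrier loc_ring\<close> by (rule loc_carrierE)
      moreover from this have "frc (- a * s + a * s) (s * s) = frc 0 1"
        by (intro frc_eqI) (auto simp: simps)
      ultimately show ?thesis by (intro bexI[of _ "frc (- a) s"]) (auto simp: simps)
    qed
  qed (auto simp: simps algebra_simps elim!: loc_carrierE)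
  show "comm_monoid loc_ring"
    by (rule comm_monoidI) (auto simp: simps algebra_simps elim!: loc_carrierE)
  show "(x \<oplus>\<^bsub>loc_ring\<^esub> y) \<otimes>\<^bsub>loc_ring\<^esub> z = x \<otimes>\<^bsub>loc_ring\<^esub> z \<oplus>\<^bsub>loc_ring\<^esub> y \<otimes>\<^bsub>loc_ring\<^esub> z"
    if "x \<in> carrier loc_ring" "y \<in> carrier loc_ring" "z \<in> carrier loc_ring" for x y z
  proof -
    obtain a s b t c w where *: "x = frc a s" "y = frc b t" "z = frc c w" "s \<in> S" "t \<in> S" "w \<in> S"
      using \<open>x \<in> _\<close> \<open>y \<in> _\<close> \<open>z \<in> _\<close> by (elim loc_carrierE)
    have "frc ((a * t + b * s) * c) (s * t * w) = frc (a * c * (t * w) + b * c * (s * w)) (s * w * (t * w))"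
      using *(4-6) mult_S by (intro frc_eqI) (auto simp: algebra_simps)
    then show ?thesis using *(4-6) by (simp add: *(1-3) simps)
  qed
qed

text \<open>
  The fractions with numerator in \<open>J\<close> are the ideal generated by the image of \<open>J\<close>; clearing
  the denominator and the factor from the equality of fractions yields a single \<open>v\<close>.
\<close>

lemma mem_extended_ideal_iff:
  assumes J: "is_ideal J"
  shows "frc f 1 \<in> Idl\<^bsub>loc_ring\<^esub> ((\<lambda>a. frc a 1) ` J) \<longleftrightarrow> (\<exists>v\<in>S. v * f \<in> J)"
proof
  interpret L: cring loc_ring by (rule loc_cring)
  let ?T = "{frc a s | a s. a \<in> J \<and> s \<in> S}"
  have "ideal ?T loc_ring"
  proof (rule L.idealI_closed)
    show "?T \<subseteq> carrier loc_ring" by (auto simp: loc_carrier)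
    show "\<zero>\<^bsub>loc_ring\<^esub> \<in> ?T" using is_submodule_0[OF J] one_S by (auto simp: loc_zero)
  next
    fix x y assume "x \<in> ?T" "y \<in> ?T"
    then obtain a s b t where *: "x = frc a s" "y = frc b t" "a \<in> J" "b \<in> J" "s \<in> S" "t \<in> S" by blast
    have "a * t + b * s \<in> J"
      using is_submodule_mult[OF J UNIV_I] is_submodule_add[OF J] * by (simp add: mult.commute)
    then show "x \<oplus>\<^bsub>loc_ring\<^esub> y \<in> ?T" using * mult_S[of s t] by (auto simp: loc_add)
  next
    fix r x assume "r \<in> carrier loc_ring" "x \<in> ?T"
    then obtain a s b t where *: "x = frc a s" "r = frc b t" "a \<in> J" "s \<in> S" "t \<in> S"
      by (auto simp: loc_carrier)
    have "b * a \<in> J" using is_submodule_mult[OF J UNIV_I] * by simp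
    then show "r \<otimes>\<^bsub>loc_ring\<^esub> x \<in> ?T" "x \<otimes>\<^bsub>loc_ring\<^esub> r \<in> ?T"
      using * mult_S[of s t] mult_S[of t s] by (auto simp: loc_mult mult.commute[of a b])
  qed
  moreover have "(\<lambda>a. frc a 1) ` J \<subseteq> ?T" using one_S by auto
  moreover assume "frc f 1 \<in> Idl\<^bsub>loc_ring\<^esub> ((\<lambda>a. frc a 1) ` J)"
  ultimately have "frc f 1 \<in> ?T" by (auto simp: genideal_def)
  then obtain a s where *: "frc f 1 = frc a s" "a \<in> J" "s \<in> S" by blast
  then obtain u where "u \<in> S" "u * (f * s - a) = 0" using frc_eq_iff[of 1 s f a] one_S by auto
  then have "(u * s) * f = u * a" by (simp add: algebra_simps)
  moreover have "u * a \<in> J" using is_submodule_mult[OF J UNIV_I *(2)] .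
  moreover have "u * s \<in> S" using mult_S \<open>u \<in> S\<close> *(3) by blast
  ultimately show "\<exists>v\<in>S. v * f \<in> J" by metis
next
  interpret L: cring loc_ring by (rule loc_cring)
  assume "\<exists>v\<in>S. v * f \<in> J"
  then obtain v where v: "v \<in> S" "v * f \<in> J" by blast
  have sub: "(\<lambda>a. frc a 1) ` J \<subseteq> carrier loc_ring" using one_S by (auto simp: loc_carrier)
  interpret E: ideal "Idl\<^bsub>loc_ring\<^esub> ((\<lambda>a. frc a 1) ` J)" loc_ring by (rule L.genideal_ideal[OF sub])
  have "frc (v * f) 1 \<in> Idl\<^bsub>loc_ring\<^esub> ((\<lambda>a. frc a 1) ` J)"
    using L.genideal_self[OF sub] v(2) by blast
  moreover have "frc 1 v \<in> carrier loc_ring" using v(1) by (auto simp: loc_carrier)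
  ultimately have "frc 1 v \<otimes>\<^bsub>loc_ring\<^esub> frc (v * f) 1 \<in> Idl\<^bsub>loc_ring\<^esub> ((\<lambda>a. frc a 1) ` J)"
    by (rule E.I_l_closed)
  moreover have "frc 1 v \<otimes>\<^bsub>loc_ring\<^esub> frc (v * f) 1 = frc f 1"
    using v(1) one_S mult_S unfolding loc_mult[OF v(1) one_S]
    by (intro frc_eqI) (auto simp: mult.commute)
  ultimately show "frc f 1 \<in> Idl\<^bsub>loc_ring\<^esub> ((\<lambda>a. frc a 1) ` J)" by simp
qed

end

lemma local_contraction_iff:
  assumes "primeideal P type_ring" "is_ideal J"
  shows "f \<in> local_contraction type_ring P J \<longleftrightarrow> (\<exists>v. v \<notin> P \<and> v * f \<in> J)"
proof -
  interpret primeideal P type_ring by fact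
  have "1 \<notin> P" using one_imp_carrier I_notcarr by auto
  moreover have "x * y \<notin> P" if "x \<notin> P" "y \<notin> P" for x y using I_prime[of x y] that by auto
  ultimately have "is_multiplicative (- P)" by (simp add: is_multiplicative_def)
  from mem_extended_ideal_iff[OF this assms(2), of f] show ?thesis
    by (auto simp: local_contraction_def extended_ideal_def to_localization_def localization_def Compl_eq_Diff_UNIV)
qed

section \<open>Associated primes\<close>

lemma noetherian_maximal:
  assumes noeth: "is_noetherian (UNIV :: 'a::comm_ring_1 set)"
    and F: "F \<noteq> {}" "\<And>T. T \<in> F \<Longrightarrow> is_ideal (T :: 'a set)"
  shows "\<exists>M\<in>F. \<forall>T\<in>F. M \<subseteq> T \<longrightarrow> T = M"
proof (rule ccontr)
  assume no_max: "\<not> ?thesis"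
  have "\<exists>T'. T' \<in> F \<and> T \<subset> T'" if "T \<in> F" for T
  proof -
    have "\<not> (\<forall>T'\<in>F. T \<subseteq> T' \<longrightarrow> T' = T)" using no_max that by simp
    then show ?thesis by (auto simp: psubset_eq)
  qed
  then have "\<exists>L. \<forall>n. L n \<in> F \<and> L n \<subset> L (Suc n)"
    using F(1) by (intro dependent_nat_choice) auto
  then obtain L :: "nat \<Rightarrow> 'a set" where L: "\<And>n. L n \<in> F" "\<And>n. L n \<subset> L (Suc n)" by metis
  have mono: "mono L" using L(2) by (auto simp: mono_iff_le_Suc)
  have "is_ideal (\<Union>n. L n)" using F(2) L(1) mono by (intro is_submodule_chain_Union) auto
  then obtain G where G: "finite G" "G \<subseteq> (\<Union>n. L n)" "\<And>T. is_ideal T \<Longrightarrow> G \<subseteq> T \<Longrightarrow> (\<Union>n. L n) \<subseteq> T"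
    using noeth unfolding is_noetherian_def by (meson subset_UNIV)
  have "\<exists>m. G \<subseteq> L m" using G(1,2)
  proof (induction G rule: finite_induct)
    case (insert g G)
    then obtain m n where "G \<subseteq> L m" "g \<in> L n" by blast
    then have "insert g G \<subseteq> L (max m n)"
      using monoD[OF mono, of m "max m n"] monoD[OF mono, of n "max m n"] by auto
    then show ?case ..
  qed simp
  then obtain m where "G \<subseteq> L m" ..
  then have "L (Suc m) \<subseteq> L m" using G(3)[OF F(2)[OF L(1)]] by blast
  then show False using L(2)[of m] by blast
qed

text \<open>
  A maximal element among the annihilators modulo \<open>I\<close> of the multiples \<open>c * x\<close> outside
  \<open>I\<close> is a prime ideal.
\<close>

lemma associated_prime_exists:
  assumes noeth: "is_noetherian (UNIV :: 'a::comm_ring_1 set)"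
    and I: "is_ideal I" and x: "x \<notin> (I :: 'a set)"
  shows "\<exists>c. {a. a * (c * x) \<in> I} \<in> associated_primes type_ring I"
proof -
  define F where "F = {{a. a * (c * x) \<in> I} | c. c * x \<notin> I}"
  have "F \<noteq> {}" unfolding F_def using x by (auto intro!: exI[of _ 1])
  moreover have "is_ideal T" if "T \<in> F" for T
    using that is_ideal_mult_preimage[OF I] by (auto simp: F_def)
  ultimately obtain M where M: "M \<in> F" "\<And>T. T \<in> F \<Longrightarrow> M \<subseteq> T \<Longrightarrow> T = M"
    using noetherian_maximal[OF noeth, of F] by blast
  then obtain c where c: "M = {a. a * (c * x) \<in> I}" "c * x \<notin> I" by (auto simp: F_def)
  have "primeideal M type_ring"
  proof (intro primeideal.intro primeideal_axioms.intro)
    show "ideal M type_ring"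
      unfolding ideal_type_ring_iff c(1) by (rule is_ideal_mult_preimage[OF I])
    show "cring type_ring" by (rule type_ring.cring_axioms)
    have "1 \<notin> M" using c by simp
    then show "carrier type_ring \<noteq> M" by auto
    fix a b assume "a \<otimes>\<^bsub>type_ring\<^esub> b \<in> M"
    then have ab: "a * ((b * c) * x) \<in> I" by (simp add: c(1) mult.assoc)
    show "a \<in> M \<or> b \<in> M"
    proof (cases "b \<in> M")
      case False
      then have "(b * c) * x \<notin> I" by (simp add: c(1) mult.assoc)
      then have "{a. a * ((b * c) * x) \<in> I} \<in> F" unfolding F_def by blast
      moreover have "M \<subseteq> {a. a * ((b * c) * x) \<in> I}"
      proof
        fix a assume "a \<in> M"
        then have "b * (a * (c * x)) \<in> I" using is_submodule_mult[OF I] by (simp add: c(1))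
        then show "a \<in> {a. a * ((b * c) * x) \<in> I}" by (simp add: ac_simps)
      qed
      ultimately show ?thesis using M(2) ab by blast
    qed simp
  qed
  then have "M \<in> associated_primes type_ring I"
    unfolding associated_primes_type_ring[OF I] using c(1) by blast
  then show ?thesis using c(1) by blast
qed

section \<open>Symbolic powers\<close>

lemma symbolic_power_iff:
  assumes "is_ideal I"
  shows "f \<in> symbolic_power type_ring I s \<longleftrightarrow>
    (s > 0 \<longrightarrow> (\<forall>P\<in>associated_primes type_ring I. \<exists>v. v \<notin> P \<and> v * f \<in> ideal_gen (I ^ s)))"
proof -
  have "f \<in> local_contraction type_ring P (ideal_gen (I ^ s)) \<longleftrightarrow> (\<exists>v. v \<notin> P \<and> v * f \<in> ideal_gen (I ^ s))"
    if "P \<in> associated_primes type_ring I" for P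
    using that local_contraction_iff[OF _ ideal_gen_ideal] associated_primes_type_ring[OF assms] by blast
  then show ?thesis
    by (simp add: symbolic_power_def ideal_power_type_ring[OF assms])
qed

lemma associated_prime_mult:
  assumes "is_ideal I" "P \<in> associated_primes type_ring I" "v \<notin> P" "w \<notin> P"
  shows "v * w \<notin> P"
proof -
  interpret primeideal P type_ring using assms(1,2) by (simp add: associated_primes_type_ring)
  show ?thesis using I_prime[of v w] assms(3,4) by auto
qed

lemma symbolic_power_mult:
  assumes I: "is_ideal I"
    and x: "x \<in> symbolic_power type_ring I a" and y: "y \<in> symbolic_power type_ring I b"
  shows "x * y \<in> symbolic_power type_ring I (a + b)"
proof -
  have "\<exists>v. v \<notin> P \<and> v * (x * y) \<in> ideal_gen (I ^ (a + b))"
    if P: "P \<in> associated_primes type_ring I" and "a + b > 0" for P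
  proof -
    have *: "v * (z * z') \<in> ideal_gen G" if "v * z \<in> ideal_gen G" for v z z' and G :: "'a set"
      using is_submodule_mult[OF ideal_gen_ideal UNIV_I that, of z'] by (simp add: ac_simps)
    consider "a = 0" "b > 0" | "a > 0" "b = 0" | "a > 0" "b > 0" using \<open>a + b > 0\<close> by linarith
    then show ?thesis
    proof cases
      case 1
      then show ?thesis using y P * unfolding symbolic_power_iff[OF I] by (metis add_0 mult.commute)
    next
      case 2
      then show ?thesis using x P * unfolding symbolic_power_iff[OF I] by (metis add.right_neutral)
    next
      case 3
      then obtain v w where *: "v \<notin> P" "w \<notin> P" "v * x \<in> ideal_gen (I ^ a)" "w * y \<in> ideal_gen (I ^ b)"
        using x y P unfolding symbolic_power_iff[OF I] by blast
      have "(v * x) * (w * y) \<in> ideal_gen (I ^ a * I ^ b)" by (rule ideal_gen_mult) (fact *)+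
      then have "(v * w) * (x * y) \<in> ideal_gen (I ^ (a + b))" by (simp add: power_add ac_simps)
      then show ?thesis using associated_prime_mult[OF I P *(1,2)] by blast
    qed
  qed
  then show ?thesis unfolding symbolic_power_iff[OF I] by blast
qed

text \<open>
  An element of the \<open>s\<close>-th symbolic power outside \<open>I\<close> would have a nonzero multiple modulo
  \<open>I\<close> whose annihilator is an associated prime \<open>P\<close>; but a multiplier outside
  \<open>P\<close> brings the element into \<open>I\<close>.
\<close>

lemma symbolic_power_subset:
  assumes noeth: "is_noetherian (UNIV :: 'a::comm_ring_1 set)"
    and I: "is_ideal (I :: 'a set)" and "s > 0"
  shows "symbolic_power type_ring I s \<subseteq> I"
proof
  fix x assume x: "x \<in> symbolic_power type_ring I s"
  show "x \<in> I"
  proof (rule ccontr)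
    assume "x \<notin> I"
    then obtain c where c: "{a. a * (c * x) \<in> I} \<in> associated_primes type_ring I"
      using associated_prime_exists[OF noeth I] by blast
    have "\<forall>P\<in>associated_primes type_ring I. \<exists>v. v \<notin> P \<and> v * x \<in> ideal_gen (I ^ s)"
      using x \<open>s > 0\<close> by (simp add: symbolic_power_iff[OF I])
    from bspec[OF this c] obtain v where v: "\<not> v * (c * x) \<in> I" "v * x \<in> ideal_gen (I ^ s)" by auto
    have "ideal_gen (I ^ s) \<subseteq> ideal_gen (I ^ 1)" using \<open>s > 0\<close> by (intro ideal_gen_power_antimono) simp
    also have "\<dots> = I" unfolding power_one_right by (rule hull_same[of is_ideal, OF I])
    finally have "v * x \<in> I" using v(2) by blast
    then have "c * (v * x) \<in> I" by (rule is_submodule_mult[OF I UNIV_I])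
    then show False using v(1) by (simp add: ac_simps)
  qed
qed

section \<open>Consequences of the Noetherian property of the symbolic Rees algebra\<close>

lemma mem_up_type_ring: "p \<in> up type_ring \<longleftrightarrow> (\<exists>n. \<forall>m>n. p m = 0)"
  by (auto simp: up_def bound_def)

context
  fixes I :: "'a::comm_ring_1 set"
  assumes I: "is_ideal I"
begin

abbreviation srees :: "('a, nat \<Rightarrow> 'a) up_ring"
  where "srees \<equiv> symbolic_Rees_algebra type_ring I"

abbreviation spower :: "nat \<Rightarrow> 'a set"
  where "spower \<equiv> symbolic_power type_ring I"

lemma srees_carrier: "carrier srees = {p \<in> up type_ring. \<forall>s. p s \<in> spower s}"
  by (auto simp: symbolic_Rees_algebra_def UP_def)

lemma srees_ops:
  "\<zero>\<^bsub>srees\<^esub> = (\<lambda>n. 0)"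
  "p \<in> up type_ring \<Longrightarrow> q \<in> up type_ring \<Longrightarrow> p \<oplus>\<^bsub>srees\<^esub> q = (\<lambda>n. p n + q n)"
  "p \<in> up type_ring \<Longrightarrow> q \<in> up type_ring \<Longrightarrow> p \<otimes>\<^bsub>srees\<^esub> q = (\<lambda>n. \<Sum>i\<le>n. p i * q (n - i))"
  by (simp_all add: symbolic_Rees_algebra_def UP_def)

definition graded_ideal :: "(nat \<Rightarrow> 'a set) \<Rightarrow> bool"
  where "graded_ideal Q \<longleftrightarrow> (\<forall>s. is_ideal (Q s)) \<and>
    (\<forall>i j x y. x \<in> spower i \<longrightarrow> y \<in> Q j \<longrightarrow> x * y \<in> Q (i + j))"

definition with_coefficients_in :: "(nat \<Rightarrow> 'a set) \<Rightarrow> (nat \<Rightarrow> 'a) set"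
  where "with_coefficients_in Q = {p \<in> carrier srees. \<forall>s. p s \<in> Q s}"

lemma graded_ideal_imp_ideal:
  assumes "ring srees" "graded_ideal Q"
  shows "ideal (with_coefficients_in Q) srees"
proof -
  interpret ring srees by fact
  have Q: "is_ideal (Q s)" "x \<in> spower i \<Longrightarrow> y \<in> Q j \<Longrightarrow> x * y \<in> Q (i + j)" for s x y i j
    using assms(2) by (auto simp: graded_ideal_def)
  have up: "p \<in> up type_ring" "p s \<in> spower s" if "p \<in> carrier srees" for p s
    using that by (auto simp: srees_carrier)
  have mult: "(p \<otimes>\<^bsub>srees\<^esub> q) s \<in> Q s" "(q \<otimes>\<^bsub>srees\<^esub> p) s \<in> Q s"
    if p: "p \<in> carrier srees" and q: "q \<in> with_coefficients_in Q" for p q s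
  proof -
    have q': "q \<in> carrier srees" "q s \<in> Q s" for s using q by (auto simp: with_coefficients_in_def)
    have "p i * q (s - i) \<in> Q s" if "i \<le> s" for i
      using Q(2)[OF up(2)[OF p] q'(2), of i "s - i"] that by simp
    then show "(p \<otimes>\<^bsub>srees\<^esub> q) s \<in> Q s"
      by (auto simp: srees_ops(3)[OF up(1)[OF p] up(1)[OF q'(1)]] intro!: is_submodule_sum[OF Q(1)])
    have "q i * p (s - i) \<in> Q s" if "i \<le> s" for i
      using Q(2)[OF up(2)[OF p] q'(2), of "s - i" i] that by (simp add: mult.commute)
    then show "(q \<otimes>\<^bsub>srees\<^esub> p) s \<in> Q s"
      by (auto simp: srees_ops(3)[OF up(1)[OF q'(1)] up(1)[OF p]] intro!: is_submodule_sum[OF Q(1)])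
  qed
  show ?thesis
  proof (rule idealI_closed)
    show "with_coefficients_in Q \<subseteq> carrier srees" by (auto simp: with_coefficients_in_def)
    show "\<zero>\<^bsub>srees\<^esub> \<in> with_coefficients_in Q"
      using zero_closed is_submodule_0[OF Q(1)] by (simp add: with_coefficients_in_def srees_ops(1))
    show "p \<oplus>\<^bsub>srees\<^esub> q \<in> with_coefficients_in Q"
      if "p \<in> with_coefficients_in Q" "q \<in> with_coefficients_in Q" for p q
      using that a_closed[of p q] is_submodule_add[OF Q(1)] up(1)
      by (simp add: with_coefficients_in_def srees_ops(2))
    show "p \<otimes>\<^bsub>srees\<^esub> q \<in> with_coefficients_in Q" "q \<otimes>\<^bsub>srees\<^esub> p \<in> with_coefficients_in Q"
      if "p \<in> carrier srees" "q \<in> with_coefficients_in Q" for p q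
      using that mult[OF that] by (auto simp: with_coefficients_in_def)
  qed
qed

text \<open>
  This turns the Noetherian property of the symbolic Rees algebra into statements about the base ring:
  \<open>Q\<close> is compared with a well-chosen graded ideal \<open>Q'\<close> by checking coefficients of the
  finitely many elements of \<open>H\<close>, without explicit linear combinations.
\<close>

lemma graded_ideal_generators:
  assumes noeth: "noetherian_ring srees" and Q: "graded_ideal Q"
  obtains H where "finite H" "H \<subseteq> with_coefficients_in Q"
    "\<And>Q'. graded_ideal Q' \<Longrightarrow> H \<subseteq> with_coefficients_in Q' \<Longrightarrow>
      with_coefficients_in Q \<subseteq> with_coefficients_in Q'"
proof -
  interpret noetherian_ring srees by fact
  obtain H where H: "H \<subseteq> carrier srees" "finite H" "with_coefficients_in Q = Idl\<^bsub>srees\<^esub> H"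
    using finetely_gen graded_ideal_imp_ideal[OF ring_axioms Q] by blast
  have "H \<subseteq> with_coefficients_in Q" using genideal_self[OF H(1)] H(3) by simp
  moreover have "with_coefficients_in Q \<subseteq> with_coefficients_in Q'"
    if "graded_ideal Q'" "H \<subseteq> with_coefficients_in Q'" for Q'
    using genideal_minimal[OF graded_ideal_imp_ideal[OF ring_axioms that(1)] that(2)] H(3) by simp
  ultimately show ?thesis using that H(2) by blast
qed

lemma zero_in_spower: "0 \<in> spower s"
  unfolding symbolic_power_iff[OF I]
proof (intro impI ballI)
  fix P assume P: "P \<in> associated_primes type_ring I"
  then interpret primeideal P type_ring by (simp add: associated_primes_type_ring[OF I])
  have "1 \<notin> P" using one_imp_carrier I_notcarr by auto
  moreover have "1 * 0 \<in> ideal_gen (I ^ s)" using is_submodule_0[OF ideal_gen_ideal] by simp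
  ultimately show "\<exists>v. v \<notin> P \<and> v * 0 \<in> ideal_gen (I ^ s)" by blast
qed

lemma monomial_in_coefficients:
  assumes "graded_ideal Q" "x \<in> spower s" "x \<in> Q s"
  shows "(\<lambda>n. if n = s then x else 0) \<in> with_coefficients_in Q"
  using assms zero_in_spower is_submodule_0[of UNIV "Q _"]
  by (auto simp: with_coefficients_in_def srees_carrier mem_up_type_ring graded_ideal_def intro!: exI[of _ s])

lemma spower_0: "spower 0 = UNIV"
  by (auto simp: symbolic_power_def)

text \<open>
  The base ring is the quotient of the algebra by its elements of positive degree.
\<close>

lemma base_ring_noetherian:
  assumes noeth: "noetherian_ring srees"
  shows "is_noetherian (UNIV :: 'a set)"
  unfolding is_noetherian_def
proof (intro allI impI)
  fix T :: "'a set" assume T: "is_ideal T"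
  define Q where "Q T s = (if s = 0 then T else UNIV)" for T :: "'a set" and s :: nat
  have Q: "graded_ideal (Q T)" if "is_ideal T" for T
    using that is_submodule_mult[OF that] by (auto simp: graded_ideal_def Q_def is_submodule_def[of _ UNIV])
  obtain H where H: "finite H" "H \<subseteq> with_coefficients_in (Q T)"
    "\<And>Q'. graded_ideal Q' \<Longrightarrow> H \<subseteq> with_coefficients_in Q' \<Longrightarrow>
      with_coefficients_in (Q T) \<subseteq> with_coefficients_in Q'"
    by (rule graded_ideal_generators[OF noeth Q[OF T]]) (rule that)
  have zero: "p \<in> with_coefficients_in (Q T) \<longleftrightarrow> p \<in> carrier srees \<and> p 0 \<in> T" for p T
    by (auto simp: with_coefficients_in_def Q_def)
  have "T \<subseteq> T'" if T': "is_ideal T'" "(\<lambda>p. p 0) ` H \<subseteq> T'" for T'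
  proof
    fix x assume x: "x \<in> T"
    have "H \<subseteq> with_coefficients_in (Q T')" using T'(2) subsetD[OF H(2)] by (auto simp: zero)
    then have "with_coefficients_in (Q T) \<subseteq> with_coefficients_in (Q T')" by (rule H(3)[OF Q[OF T'(1)]])
    moreover have "(\<lambda>n. if n = 0 then x else 0) \<in> with_coefficients_in (Q T)"
      using x by (intro monomial_in_coefficients Q T) (simp_all add: Q_def spower_0)
    ultimately have "(\<lambda>n. if n = 0 then x else 0) \<in> with_coefficients_in (Q T')" by blast
    then show "x \<in> T'" unfolding zero by simp
  qed
  then show "\<exists>G. finite G \<and> G \<subseteq> T \<and> (\<forall>T'. is_ideal T' \<longrightarrow> G \<subseteq> T' \<longrightarrow> T \<subseteq> T')"
    using H(1,2) by (intro exI[of _ "(\<lambda>p. p 0) ` H"]) (auto simp: zero)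
qed

text \<open>
  Generators of the ideal of elements of positive degree involve only degrees up to some \<open>D\<close>.
\<close>

lemma symbolic_powers_generated_in_bounded_degree:
  assumes noeth: "noetherian_ring srees"
  obtains D where "\<And>s. s > 0 \<Longrightarrow>
    spower s \<subseteq> ideal_gen (\<Union>a\<in>{1..min D s}. spower a * spower (s - a))"
proof -
  define Q :: "nat \<Rightarrow> 'a set" where "Q s = (if s = 0 then {0} else UNIV)" for s
  have Q: "graded_ideal Q" by (auto simp: graded_ideal_def Q_def is_submodule_def)
  obtain H where H: "finite H" "H \<subseteq> with_coefficients_in Q"
    "\<And>Q'. graded_ideal Q' \<Longrightarrow> H \<subseteq> with_coefficients_in Q' \<Longrightarrow>
      with_coefficients_in Q \<subseteq> with_coefficients_in Q'"
    by (rule graded_ideal_generators[OF noeth Q]) (rule that)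
  have "\<forall>p\<in>H. \<exists>n. \<forall>m>n. p m = 0"
    using H(2) by (auto simp: with_coefficients_in_def srees_carrier mem_up_type_ring)
  then obtain d where d: "\<And>p m. p \<in> H \<Longrightarrow> m > d p \<Longrightarrow> p m = 0" by metis
  define D where "D = Max (insert 0 (d ` H))"
  have D: "p m = 0" if "p \<in> H" "m > D" for p m
  proof -
    have "d p \<le> D" unfolding D_def using H(1) that(1) by simp
    then show ?thesis using d that by simp
  qed
  (* E collects what the components of degree at most D generate, and contains the generators H. *)
  define E where "E s = ideal_gen (\<Union>a\<in>{1..min D s}. spower a * spower (s - a))" for s
  have E: "graded_ideal E"
    unfolding graded_ideal_def
  proof (intro conjI allI impI)
    show "is_ideal (E s)" for s unfolding E_def by (rule ideal_gen_ideal)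
    fix i j x y assume x: "x \<in> spower i" and y: "y \<in> E j"
    have "y * x \<in> E (i + j)" if a: "a \<in> {1..min D j}" and "y \<in> spower a * spower (j - a)" for a y
    proof -
      obtain u v where uv: "y = u * v" "u \<in> spower a" "v \<in> spower (j - a)"
        using \<open>y \<in> _\<close> by (elim set_times_elim)
      have "v * x \<in> spower (i + j - a)" using symbolic_power_mult[OF I uv(3) x] a by (simp add: ac_simps)
      then have "y * x \<in> spower a * spower (i + j - a)" using uv by (simp add: mult.assoc set_times_intro)
      moreover have "a \<in> {1..min D (i + j)}" using a by simp
      ultimately show ?thesis unfolding E_def by (blast intro: hull_inc)
    qed
    then have "(\<Union>a\<in>{1..min D j}. spower a * spower (j - a)) \<subseteq> {y. y * x \<in> E (i + j)}" by blast
    then have "E j \<subseteq> {y. y * x \<in> E (i + j)}"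
      unfolding E_def by (intro ideal_gen_minimal is_ideal_mult_preimage ideal_gen_ideal)
    then show "x * y \<in> E (i + j)" using y by (auto simp: mult.commute)
  qed
  have "H \<subseteq> with_coefficients_in E"
  proof
    fix p assume p: "p \<in> H"
    then have "p \<in> with_coefficients_in Q" using H(2) by blast
    then have carr: "p \<in> carrier srees" and "p 0 \<in> Q 0" unfolding with_coefficients_in_def by blast+
    then have "p 0 = 0" by (simp add: Q_def)
    have "p s \<in> E s" for s
    proof (cases "1 \<le> s \<and> s \<le> D")
      case True
      have "p s * 1 \<in> spower s * spower (s - s)"
        using carr by (intro set_times_intro) (auto simp: srees_carrier spower_0)
      then show ?thesis unfolding E_def using True by (auto intro!: hull_inc bexI[of _ s])
    next
      case False
      then have "p s = 0" using \<open>p 0 = 0\<close> D[OF p, of s] by (cases "s = 0") auto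
      then show ?thesis using is_submodule_0[OF ideal_gen_ideal] by (simp add: E_def)
    qed
    then show "p \<in> with_coefficients_in E" using carr by (simp add: with_coefficients_in_def)
  qed
  then have le: "with_coefficients_in Q \<subseteq> with_coefficients_in E" by (rule H(3)[OF E])
  have "spower s \<subseteq> E s" if "s > 0" for s
  proof
    fix x assume "x \<in> spower s"
    then have "(\<lambda>n. if n = s then x else 0) \<in> with_coefficients_in Q"
      using that by (intro monomial_in_coefficients Q) (simp_all add: Q_def)
    then have "(\<lambda>n. if n = s then x else 0) \<in> with_coefficients_in E" using le by blast
    then have "(if s = s then x else 0) \<in> E s" unfolding with_coefficients_in_def by blast
    then show "x \<in> E s" by simp
  qed
  then show ?thesis using that unfolding E_def by blast
qed

theorem resurgences_rational:
  assumes noeth: "noetherian_ring srees"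
  shows "\<exists>x\<in>\<rat>. 0 \<le> x \<and> resurgence type_ring I = ennreal x"
    and "\<exists>x\<in>\<rat>. 0 \<le> x \<and> asymptotic_resurgence type_ring I = ennreal x"
proof -
  obtain D where D: "\<And>s. s > 0 \<Longrightarrow>
    spower s \<subseteq> ideal_gen (\<Union>a\<in>{1..min D s}. spower a * spower (s - a))"
    by (rule symbolic_powers_generated_in_bounded_degree[OF noeth]) (rule that)
  note base = base_ring_noetherian[OF noeth]
  have "1 \<in> spower 0" by (simp add: spower_0)
  note rat = resurgence_rational_of_graded_family[where K = spower,
      OF base this symbolic_power_mult[OF I] symbolic_power_subset[OF base I] D]
  show "\<exists>x\<in>\<rat>. 0 \<le> x \<and> resurgence type_ring I = ennreal x"
    unfolding resurgence_def ideal_power_type_ring[OF I] by (rule rat(1))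
  show "\<exists>x\<in>\<rat>. 0 \<le> x \<and> asymptotic_resurgence type_ring I = ennreal x"
    unfolding asymptotic_resurgence_def ideal_power_type_ring[OF I] by (rule rat(2))
qed

end

theorem theorem3p7:
  fixes I :: "('n::finite, 'k::field) mpolynomial set"
  assumes "ideal I mpoly_ring"
    and "noetherian_ring (symbolic_Rees_algebra mpoly_ring I)"
  shows "(\<exists>q\<in>\<rat>. 0 \<le> q \<and> resurgence mpoly_ring I = ennreal q) \<and>
         (\<exists>q\<in>\<rat>. 0 \<le> q \<and> asymptotic_resurgence mpoly_ring I = ennreal q)"
  using assms resurgences_rational[of I] unfolding mpoly_ring_def ideal_type_ring_iff by blast

end
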